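(* The formula ($\mathcal{G}$ is a surjection from $\mathbb{N}$ onto $\gimel\kappa$) is realized in the realizability model $\mathcal{N}_{\mathcal{B}}$. More precisely: (i) $(\theta_0,\mathbf{1})\Vdash_{\mathcal{B}}\forall x\forall y\forall y'\big((x,y)\,\varepsilon\,\mathcal{G},\;y\neq y'\to(x,y')\not\varepsilon\,\mathcal{G}\big)$ with $\theta_0=\lambda n\lambda k\lambda x(x)n$; (ii) $(\theta_1,\mathbf{1})\Vdash_{\mathcal{B}}\forall y^{\gimel\kappa}\big[\forall x^{\mathrm{int}}((x,y)\not\varepsilon\,\mathcal{G})\to\bot\big]$ with $\theta_1=\lambda n\lambda x((((n)(\mathsf{C}\mathsf{B})(\mathsf{C})\sigma^* )(\mathsf{C})x)\underline{0}^* )(\sigma)n$, where $\sigma=(\mathsf{B}\mathsf{W})(\mathsf{B})\mathsf{B}$ is the successor combinator.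
   Context: Setting: $\mathcal{A}$ is a realizability algebra (terms $\Lambda$, stacks $\Pi$, processes $\Lambda\star\Pi$, combinators $\mathsf{B},\mathsf{C},\mathsf{I},\mathsf{K},\mathsf{W},\mathsf{cc}$, continuations $\mathsf{k}_\pi$, pole $\perp\!\!\!\perp$) in a ground model $\mathcal{M}$ of ZF+V=L. $\underline{n}=(\sigma)^n\underline{0}$ with $\underline{0}=\mathsf{K}\mathsf{I}$. Notation: $\xi\cdot\pi$ is push, $\varepsilon$ / $\not\varepsilon$ are the non-extensional membership / non-membership of ZF$_\varepsilon$, $\gimel X=X\times\Pi$ with $\forall x^{\gimel X}$ the corresponding restricted quantifier, and $\forall x^{\mathrm{int}}F[x]$ has truth value $\{\underline{n}\cdot\pi;\,n\in\mathbb{N},\pi\in\|F[n]\|\}$ (quantification over the integers of the model). Starred combinators in $\mathcal{A}$: $\mathsf{B}^*=\lambda n\lambda x\lambda y\lambda z(xn)(\mathsf{C})yz$, $\mathsf{C}^*=\lambda n\lambda x\lambda y\lambda z(x)nzy$, $\mathsf{I}^*=\lambda n\lambda x(x)n$, $\mathsf{K}^*=\lambda n\lambda x\lambda y(x)n$, $\mathsf{W}^*=\lambda n\lambda x\lambda y(x)nyy$, $\mathsf{k}^*_\pi=\lambda n\lambda x(\mathsf{k}_\pi)(x)n$, $\mathsf{cc}^*=\lambda n\lambda x(\mathsf{cc})\lambda k(xn)\lambda n\lambda x(k)(x)n$; for a closed combinatory term, $(tu)^*=\mathsf{C}t^*u^*$, so $\underline{0}^*=\mathsf{C}\mathsf{K}^*\mathsf{I}^*$,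 $\sigma^*$ is the star of $\sigma$, and $\underline{n}^*=(\mathsf{C}\sigma^* )^n\underline{0}^*$. $\kappa\geq\mathrm{card}(\Lambda\cup\Pi)$ is an infinite cardinal of $\mathcal{M}$; $P$ is the tree $\kappa^{<\omega}$ (functions with domain an integer and values in $\kappa$) with a least element $\mathbf{0}$ added; its greatest element $\mathbf{1}$ is the empty function, and $pq$ is the greater (in $P$-order, i.e. the longer function) of $p,q$ if they are comparable nonzero, $\mathbf{0}$ otherwise. The algebra $\mathcal{B}$ has terms $\Lambda\times P$, stacks $\Pi\times P$, processes $(\Lambda\star\Pi)\times P$, with $(\xi,p)\cdot(\pi,q)=(\xi\cdot\pi,pq)$, $(\xi,p)\star(\pi,q)=(\xi\star\pi,pq)$, $(\xi,p)(\eta,q)=(\mathsf{C}\xi\eta,pq)$, combinators $(\mathsf{B}^*,\mathbf{1}),\dots,(\mathsf{cc}^*,\mathbf{1})$, continuations $(\mathsf{k}^*_\pi,p)$, and pole: $(\xi\star\pi,p)\in\perp\!\!\!\perp_{\mathcal{B}}$ iff for all $n\in\mathbb{N}$, if $p\neq\mathbf{0}$ and $\mathrm{dom}(p)\leq n$ then $\xi\star\underline{n}\cdot\pi\in\perp\!\!\!\perp$. $\Vdash_{\mathcal{B}}$ denotes realizability in the model $\mathcal{N}_{\mathcal{B}}$ built from $\mathcal{B}$. Finally $\mathcal{G}=\{((m,\alpha),(\pi,p));\;m\in\mathbb{N},\alpha\in\kappa,\pi\in\Pi,p\in P\setminus\{\mathbf{0}\},\,p(m)\text{ defined and }p(m)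=\alpha\}$.
   Formalization: In (i) the hypothesis (x,y) ε G is read as the set of continuations k_π with π in the truth value of (x,y) ε̸ G; with the plain negation ((x,y) ε̸ G → ⊥) the given θ_0, which discards this argument, fails. The pole of B is assumed well defined. *)

theory Defs
  imports Main
begin

section \<open>Models of ZF + V=L\<close>

text \<open>
  A ground model is a type \<open>'m\<close> of individuals with an arbitrary binary relation \<open>E\<close>
  satisfying the first-order axioms; it need be neither well-founded nor an omega-model.
  Formulas are needed as objects only for the replacement scheme.
\<close>

datatype fm = Mem nat nat | Eq nat nat | Neg fm | Conj fm fm | Forall nat fm

primrec sat :: "('m \<Rightarrow> 'm \<Rightarrow> bool) \<Rightarrow> fm \<Rightarrow> (nat \<Rightarrow> 'm) \<Rightarrow> bool" where
  "sat E (Mem i j) e = E (e i) (e j)"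
| "sat E (Eq i j) e = (e i = e j)"
| "sat E (Neg f) e = (\<not> sat E f e)"
| "sat E (Conj f g) e = (sat E f e \<and> sat E g e)"
| "sat E (Forall i f) e = (\<forall>a. sat E f (e(i := a)))"

context
  fixes E :: "'m \<Rightarrow> 'm \<Rightarrow> bool"  (infix "\<^bold>\<in>" 50)
begin

definition ext :: "'m \<Rightarrow> 'm set" where
  "ext x = {z. z \<^bold>\<in> x}"

definition is_set :: "'m set \<Rightarrow> bool" where
  "is_set X \<longleftrightarrow> (\<exists>a. ext a = X)"

definition emp :: 'm where
  "emp = (THE z. ext z = {})"

definition succ :: "'m \<Rightarrow> 'm" where
  "succ x = (THE z. ext z = insert x (ext x))"

definition upair :: "'m \<Rightarrow> 'm \<Rightarrow> 'm" where
  "upair x y = (THE z. ext z = {x, y})"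

definition opair :: "'m \<Rightarrow> 'm \<Rightarrow> 'm" where
  "opair x y = upair (upair x x) (upair x y)"

definition mfst :: "'m \<Rightarrow> 'm" where
  "mfst z = (THE x. \<exists>y. z = opair x y)"

definition msnd :: "'m \<Rightarrow> 'm" where
  "msnd z = (THE y. \<exists>x. z = opair x y)"

definition mprod :: "'m set \<Rightarrow> 'm set \<Rightarrow> 'm set" where
  "mprod X Y = {opair x y | x y. x \<in> X \<and> y \<in> Y}"

definition is_inductive :: "'m \<Rightarrow> bool" where
  "is_inductive I \<longleftrightarrow>
     (\<exists>z. z \<^bold>\<in> I \<and> ext z = {}) \<and>
     (\<forall>x. x \<^bold>\<in> I \<longrightarrow> (\<exists>y. y \<^bold>\<in> I \<and> ext y = insert x (ext x)))"

definition nats :: "'m set" where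
  "nats = {n. \<forall>I. is_inductive I \<longrightarrow> n \<^bold>\<in> I}"

definition ZF_model :: bool where
  "ZF_model \<longleftrightarrow>
     \<comment> \<open>extensionality, foundation, pairing, union, power set, infinity, replacement\<close>
     (\<forall>x y. ext x = ext y \<longrightarrow> x = y) \<and>
     (\<forall>x. ext x \<noteq> {} \<longrightarrow> (\<exists>y. y \<^bold>\<in> x \<and> ext x \<inter> ext y = {})) \<and>
     (\<forall>x y. \<exists>z. ext z = {x, y}) \<and>
     (\<forall>x. \<exists>z. ext z = {w. \<exists>y. y \<^bold>\<in> x \<and> w \<^bold>\<in> y}) \<and>
     (\<forall>x. \<exists>z. ext z = {y. ext y \<subseteq> ext x}) \<and>
     (\<exists>I. is_inductive I) \<and>
     (\<forall>f e a.
        (\<forall>x y y'. x \<^bold>\<in> a \<and> sat E f (e(0 := x, 1 := y)) \<and> sat E f (e(0 := x, 1 := y')) \<longrightarrow> y = y') \<longrightarrow>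
        (\<exists>b. ext b = {y. \<exists>x. x \<^bold>\<in> a \<and> sat E f (e(0 := x, 1 := y))}))"

definition is_fun :: "'m \<Rightarrow> bool" where
  "is_fun f \<longleftrightarrow>
     (\<forall>z. z \<^bold>\<in> f \<longrightarrow> (\<exists>x y. z = opair x y)) \<and>
     (\<forall>x y y'. opair x y \<^bold>\<in> f \<and> opair x y' \<^bold>\<in> f \<longrightarrow> y = y')"

definition fdom :: "'m \<Rightarrow> 'm set" where
  "fdom f = {x. \<exists>y. opair x y \<^bold>\<in> f}"

definition fran :: "'m \<Rightarrow> 'm set" where
  "fran f = {y. \<exists>x. opair x y \<^bold>\<in> f}"

definition fapp :: "'m \<Rightarrow> 'm \<Rightarrow> 'm" where
  "fapp f x = (THE y. opair x y \<^bold>\<in> f)"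

definition ordinal :: "'m \<Rightarrow> bool" where
  "ordinal a \<longleftrightarrow>
     (\<forall>x. x \<^bold>\<in> a \<longrightarrow> ext x \<subseteq> ext a \<and> (\<forall>y. y \<^bold>\<in> x \<longrightarrow> ext y \<subseteq> ext x))"

text \<open>
  V=L is expressed through the Goedel operations: for transitive \<open>X\<close>, the definable subsets
  of \<open>X\<close> are the subsets of \<open>X\<close> in the closure of \<open>X \<union> {X}\<close> under these operations.
  Triples are \<open>((u,v),w)\<close>.
\<close>

definition goedel_op :: "'m \<Rightarrow> 'm \<Rightarrow> 'm \<Rightarrow> bool" where
  "goedel_op x y z \<longleftrightarrow>
     ext z = {x, y} \<or>
     ext z = mprod (ext x) (ext y) \<or>
     ext z = {opair u v | u v. u \<^bold>\<in> x \<and> v \<^bold>\<in> y \<and> u \<^bold>\<in> v} \<or>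
     ext z = ext x - ext y \<or>
     ext z = ext x \<inter> ext y \<or>
     ext z = {w. \<exists>u. u \<^bold>\<in> x \<and> w \<^bold>\<in> u} \<or>
     ext z = fdom x \<or>
     ext z = {opair u v | u v. opair v u \<^bold>\<in> x} \<or>
     ext z = {opair (opair u v) w | u v w. opair (opair u w) v \<^bold>\<in> x} \<or>
     ext z = {opair (opair u v) w | u v w. opair (opair v w) u \<^bold>\<in> x}"

definition definable_subset :: "'m \<Rightarrow> 'm \<Rightarrow> bool" where
  "definable_subset X y \<longleftrightarrow>
     ext y \<subseteq> ext X \<and>
     (\<forall>C. X \<^bold>\<in> C \<and> ext X \<subseteq> ext C \<and>
          (\<forall>u v w. u \<^bold>\<in> C \<and> v \<^bold>\<in> C \<and> goedel_op u v w \<longrightarrow> w \<^bold>\<in> C) \<longrightarrow> y \<^bold>\<in> C)"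

definition V_eq_L :: bool where
  "V_eq_L \<longleftrightarrow>
     (\<forall>x. \<exists>a f. ordinal a \<and> is_fun f \<and> fdom f = ext a \<and>
        (\<forall>b. b \<^bold>\<in> a \<longrightarrow> ext (fapp f b) = {y. \<exists>c. c \<^bold>\<in> b \<and> definable_subset (fapp f c) y}) \<and>
        (\<exists>b. b \<^bold>\<in> a \<and> x \<^bold>\<in> fapp f b))"

definition injects :: "'m set \<Rightarrow> 'm set \<Rightarrow> bool" where
  "injects X Y \<longleftrightarrow>
     (\<exists>f. is_fun f \<and> fdom f = X \<and> fran f \<subseteq> Y \<and>
        (\<forall>x x' y. opair x y \<^bold>\<in> f \<and> opair x' y \<^bold>\<in> f \<longrightarrow> x = x'))"

definition infinite_cardinal :: "'m \<Rightarrow> bool" where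
  "infinite_cardinal k \<longleftrightarrow>
     ordinal k \<and> nats \<subseteq> ext k \<and> (\<forall>b. b \<^bold>\<in> k \<longrightarrow> \<not> injects (ext k) (ext b))"

text \<open>
  \<open>iter f a n\<close> is the value at \<open>n \<in> nats\<close> of the iteration of \<open>f\<close> from \<open>a\<close>, computed in the
  model, so that it makes sense for nonstandard \<open>n\<close>.
\<close>

definition iter :: "('m \<Rightarrow> 'm) \<Rightarrow> 'm \<Rightarrow> 'm \<Rightarrow> 'm" where
  "iter f a n =
     (THE y. \<exists>g. is_fun g \<and> fdom g = ext (succ n) \<and> fapp g emp = a \<and>
        (\<forall>k. k \<^bold>\<in> n \<longrightarrow> fapp g (succ k) = f (fapp g k)) \<and> fapp g n = y)"

end

section \<open>Combinatory terms\<close>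

datatype combinator = CB | CC | CI | CK | CW | Ccc

datatype cterm = Var nat | Comb combinator | App cterm cterm  (infixl "\<bullet>" 90)

abbreviation "B \<equiv> Comb CB"
abbreviation "C \<equiv> Comb CC"
abbreviation "I \<equiv> Comb CI"
abbreviation "K \<equiv> Comb CK"
abbreviation "W \<equiv> Comb CW"
abbreviation "cc \<equiv> Comb Ccc"

primrec occurs :: "nat \<Rightarrow> cterm \<Rightarrow> bool" where
  "occurs x (Var y) = (x = y)"
| "occurs x (Comb c) = False"
| "occurs x (t \<bullet> u) = (occurs x t \<or> occurs x u)"

text \<open>
  Krivine's bracket abstraction, by the first applicable rule of:
  \<open>\<lambda>x t = K t\<close> if \<open>x\<close> is not in \<open>t\<close>;
  \<open>\<lambda>x x = I\<close>;
  \<open>\<lambda>x tu = C (\<lambda>x t) u\<close> if \<open>x\<close> is not in \<open>u\<close>;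
  \<open>\<lambda>x tx = t\<close> if \<open>x\<close> is not in \<open>t\<close>;
  \<open>\<lambda>x tx = W (\<lambda>x t)\<close> if \<open>x\<close> is in \<open>t\<close>;
  \<open>\<lambda>x t(uv) = \<lambda>x (B t u v)\<close> if \<open>x\<close> is in \<open>uv\<close>.
  The two auxiliary functions only serve the termination proof.
\<close>

primrec abs_weight :: "nat \<Rightarrow> cterm \<Rightarrow> nat" where
  "abs_weight x (Var y) = 1"
| "abs_weight x (Comb c) = 1"
| "abs_weight x (t \<bullet> u) =
     (if \<not> occurs x t then abs_weight x u + 1
      else if \<not> occurs x u then abs_weight x t + 1
      else abs_weight x t + 2 * abs_weight x u)"

fun arg_size :: "cterm \<Rightarrow> nat" where
  "arg_size (t \<bullet> u) = size u"
| "arg_size t = 0"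

lemma abs_weight_pos: "0 < abs_weight x t" "Suc 0 < 2 * abs_weight x t"
proof -
  show "0 < abs_weight x t" by (induction t) auto
  then show "Suc 0 < 2 * abs_weight x t" by linarith
qed

function lam :: "nat \<Rightarrow> cterm \<Rightarrow> cterm" where
  "lam x (Var y) = (if x = y then I else K \<bullet> Var y)"
| "lam x (Comb c) = K \<bullet> Comb c"
| "lam x (t \<bullet> u) =
     (if \<not> occurs x (t \<bullet> u) then K \<bullet> (t \<bullet> u)
      else if \<not> occurs x u then C \<bullet> lam x t \<bullet> u
      else case u of
        Var y \<Rightarrow> if occurs x t then W \<bullet> lam x t else t
      | u1 \<bullet> u2 \<Rightarrow> lam x (B \<bullet> t \<bullet> u1 \<bullet> u2)
      | Comb c \<Rightarrow> K \<bullet> (t \<bullet> u))"  \<comment> \<open>the last case cannot occur\<close>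
  by pat_completeness auto
termination
  by (relation "measures [\<lambda>(x, t). abs_weight x t, \<lambda>(x, t). arg_size t]")
    (use abs_weight_pos in \<open>auto split: if_splits\<close>)

text \<open>The translation \<open>t\<^sup>*\<close>; it is only used for closed terms.\<close>

primrec starred_comb :: "combinator \<Rightarrow> cterm" where
  "starred_comb CB = (let n = 0; x = 1; y = 2; z = 3 in
     lam n (lam x (lam y (lam z (Var x \<bullet> Var n \<bullet> (C \<bullet> Var y \<bullet> Var z))))))"
| "starred_comb CC = (let n = 0; x = 1; y = 2; z = 3 in
     lam n (lam x (lam y (lam z (Var x \<bullet> Var n \<bullet> Var z \<bullet> Var y)))))"
| "starred_comb CI = (let n = 0; x = 1 in lam n (lam x (Var x \<bullet> Var n)))"
| "starred_comb CK = (let n = 0; x = 1; y = 2 in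
     lam n (lam x (lam y (Var x \<bullet> Var n))))"
| "starred_comb CW = (let n = 0; x = 1; y = 2 in
     lam n (lam x (lam y (Var x \<bullet> Var n \<bullet> Var y \<bullet> Var y))))"
| "starred_comb Ccc = (let n = 0; x = 1; k = 2 in
     lam n (lam x (cc \<bullet> lam k (Var x \<bullet> Var n \<bullet> lam n (lam x (Var k \<bullet> (Var x \<bullet> Var n)))))))"

primrec starred :: "cterm \<Rightarrow> cterm" where
  "starred (Var x) = Var x"
| "starred (Comb c) = starred_comb c"
| "starred (t \<bullet> u) = C \<bullet> starred t \<bullet> starred u"

definition zero_term :: cterm where
  "zero_term = K \<bullet> I"

definition sigma :: cterm where
  "sigma = (B \<bullet> W) \<bullet> (B \<bullet> B)"

definition theta0 :: cterm where
  "theta0 = (let n = 0; k = 1; x = 2 in lam n (lam k (lam x (Var x \<bullet> Var n))))"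

definition theta1 :: cterm where
  "theta1 = (let n = 0; x = 1 in
     lam n (lam x
       (((Var n \<bullet> ((C \<bullet> B) \<bullet> (C \<bullet> starred sigma))) \<bullet> (C \<bullet> Var x)) \<bullet> starred zero_term
         \<bullet> (sigma \<bullet> Var n))))"

section \<open>Realizability algebras\<close>

record 'm ralg =
  Terms :: "'m set"
  Stacks :: "'m set"
  Procs :: "'m set"
  app :: "'m \<Rightarrow> 'm \<Rightarrow> 'm"
  push :: "'m \<Rightarrow> 'm \<Rightarrow> 'm"
  proc :: "'m \<Rightarrow> 'm \<Rightarrow> 'm"
  kont :: "'m \<Rightarrow> 'm"
  comb :: "combinator \<Rightarrow> 'm"
  pole :: "'m set"

inductive step :: "'m ralg \<Rightarrow> 'm \<Rightarrow> 'm \<Rightarrow> bool" for A where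
  "\<lbrakk>x \<in> Terms A; y \<in> Terms A; s \<in> Stacks A\<rbrakk>
     \<Longrightarrow> step A (proc A (app A x y) s) (proc A x (push A y s))"
| "\<lbrakk>x \<in> Terms A; s \<in> Stacks A\<rbrakk>
     \<Longrightarrow> step A (proc A (comb A CI) (push A x s)) (proc A x s)"
| "\<lbrakk>x \<in> Terms A; y \<in> Terms A; s \<in> Stacks A\<rbrakk>
     \<Longrightarrow> step A (proc A (comb A CK) (push A x (push A y s))) (proc A x s)"
| "\<lbrakk>x \<in> Terms A; y \<in> Terms A; s \<in> Stacks A\<rbrakk>
     \<Longrightarrow> step A (proc A (comb A CW) (push A x (push A y s))) (proc A x (push A y (push A y s)))"
| "\<lbrakk>x \<in> Terms A; y \<in> Terms A; z \<in> Terms A; s \<in> Stacks A\<rbrakk>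
     \<Longrightarrow> step A (proc A (comb A CC) (push A x (push A y (push A z s))))
              (proc A x (push A z (push A y s)))"
| "\<lbrakk>x \<in> Terms A; y \<in> Terms A; z \<in> Terms A; s \<in> Stacks A\<rbrakk>
     \<Longrightarrow> step A (proc A (comb A CB) (push A x (push A y (push A z s))))
              (proc A x (push A (app A y z) s))"
| "\<lbrakk>x \<in> Terms A; s \<in> Stacks A\<rbrakk>
     \<Longrightarrow> step A (proc A (comb A Ccc) (push A x s)) (proc A x (push A (kont A s) s))"
| "\<lbrakk>x \<in> Terms A; s \<in> Stacks A; r \<in> Stacks A\<rbrakk>
     \<Longrightarrow> step A (proc A (kont A s) (push A x r)) (proc A x s)"

definition ralg_axioms :: "'m ralg \<Rightarrow> bool" where
  "ralg_axioms A \<longleftrightarrow>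
     (\<forall>x \<in> Terms A. \<forall>y \<in> Terms A. app A x y \<in> Terms A) \<and>
     (\<forall>x \<in> Terms A. \<forall>s \<in> Stacks A. push A x s \<in> Stacks A) \<and>
     (\<forall>x \<in> Terms A. \<forall>s \<in> Stacks A. proc A x s \<in> Procs A) \<and>
     (\<forall>s \<in> Stacks A. kont A s \<in> Terms A) \<and>
     (\<forall>c. comb A c \<in> Terms A) \<and>
     pole A \<subseteq> Procs A \<and>
     (\<forall>p q. step A p q \<and> q \<in> pole A \<longrightarrow> p \<in> pole A)"

primrec val :: "'m ralg \<Rightarrow> (nat \<Rightarrow> 'm) \<Rightarrow> cterm \<Rightarrow> 'm" where
  "val A e (Var x) = e x"
| "val A e (Comb c) = comb A c"
| "val A e (t \<bullet> u) = app A (val A e t) (val A e u)"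

text \<open>Value of a closed term; the environment is irrelevant.\<close>

definition cval :: "'m ralg \<Rightarrow> cterm \<Rightarrow> 'm" where
  "cval A t = val A (\<lambda>_. comb A CI) t"

text \<open>\<open>k\<^sup>*\<^sub>\<pi> = \<lambda>n\<lambda>x (k\<^sub>\<pi>)(x)n\<close>, where variable 2 stands for the parameter \<open>k\<^sub>\<pi>\<close>.\<close>

definition starred_kont :: "'m ralg \<Rightarrow> 'm \<Rightarrow> 'm" where
  "starred_kont A s = (let n = 0; x = 1; k = 2 in
     val A ((\<lambda>_. comb A CI)(k := kont A s)) (lam n (lam x (Var k \<bullet> (Var x \<bullet> Var n)))))"

section \<open>Realizability over a ground model\<close>

text \<open>
  A fragment of the formulas of the non-extensional set theory, with parameters in the model.
  \<open>NotEq a b\<close> has truth value all stacks if \<open>a = b\<close>, and the empty set otherwise.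
  \<open>Eps a b F\<close> is \<open>a \<epsilon> b \<rightarrow> F\<close>.  As usual for a negated hypothesis, \<open>a \<epsilon> b\<close> (the negation of
  \<open>NotEps a b\<close>) stands here for the set of terms \<open>k\<^sub>\<pi>\<close> with \<open>\<pi>\<close> in the truth value of
  \<open>NotEps a b\<close>.  It is interchangeable with \<open>(NotEps a b \<^bold>\<rightarrow> Falsum) \<^bold>\<rightarrow> F\<close> as far as being
  realized by some term is concerned, but not for a given realizer: one that discards this
  hypothesis, such as \<open>theta0\<close>, does not realize the version with the implication.
  \<open>AllGimel X F\<close> quantifies over the elements of the set \<open>X\<close> of the model,
  \<open>AllInt F\<close> over its integers.
\<close>

datatype 'm zfe =
    Falsum
  | NotEps 'm 'm
  | NotEq 'm 'm
  | Imp "'m zfe" "'m zfe"  (infixr "\<^bold>\<rightarrow>" 60)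
  | Eps 'm 'm "'m zfe"
  | All "'m \<Rightarrow> 'm zfe"
  | AllGimel 'm "'m \<Rightarrow> 'm zfe"
  | AllInt "'m \<Rightarrow> 'm zfe"

context
  fixes E :: "'m \<Rightarrow> 'm \<Rightarrow> bool"  (infix "\<^bold>\<in>" 50)
begin

definition realizability_algebra :: "'m ralg \<Rightarrow> bool" where
  "realizability_algebra A \<longleftrightarrow>
     ralg_axioms A \<and>
     is_set E (Terms A) \<and> is_set E (Stacks A) \<and> is_set E (Procs A) \<and> is_set E (pole A) \<and>
     is_set E {opair E (opair E x y) (app A x y) | x y. x \<in> Terms A \<and> y \<in> Terms A} \<and>
     is_set E {opair E (opair E x s) (push A x s) | x s. x \<in> Terms A \<and> s \<in> Stacks A} \<and>
     is_set E {opair E (opair E x s) (proc A x s) | x s. x \<in> Terms A \<and> s \<in> Stacks A} \<and>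
     is_set E {opair E s (kont A s) | s. s \<in> Stacks A}"

definition numeral_term :: "'m ralg \<Rightarrow> 'm \<Rightarrow> 'm" where
  "numeral_term A n = iter E (app A (cval A sigma)) (cval A zero_term) n"

definition realizer :: "'m ralg \<Rightarrow> 'm \<Rightarrow> 'm set \<Rightarrow> bool" where
  "realizer A x F \<longleftrightarrow> x \<in> Terms A \<and> (\<forall>s \<in> F. proc A x s \<in> pole A)"

primrec truth_value :: "'m ralg \<Rightarrow> 'm zfe \<Rightarrow> 'm set" where
  "truth_value A Falsum = Stacks A"
| "truth_value A (NotEps a b) = {s \<in> Stacks A. opair E a s \<^bold>\<in> b}"
| "truth_value A (NotEq a b) = (if a = b then Stacks A else {})"
| "truth_value A (F \<^bold>\<rightarrow> G) =
     {push A x s | x s. realizer A x (truth_value A F) \<and> s \<in> truth_value A G}"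
| "truth_value A (Eps a b F) =
     {push A (kont A r) s | r s. r \<in> Stacks A \<and> opair E a r \<^bold>\<in> b \<and> s \<in> truth_value A F}"
| "truth_value A (All F) = (\<Union>a. truth_value A (F a))"
| "truth_value A (AllGimel X F) = (\<Union>a \<in> ext E X. truth_value A (F a))"
| "truth_value A (AllInt F) =
     {push A (numeral_term A n) s | n s. n \<in> nats E \<and> s \<in> truth_value A (F n)}"

definition realizes :: "'m ralg \<Rightarrow> 'm \<Rightarrow> 'm zfe \<Rightarrow> bool" where
  "realizes A x F \<longleftrightarrow> realizer A x (truth_value A F)"

section \<open>The collapsing algebra\<close>

text \<open>
  \<open>zero\<close> is the least element added to the tree of finite sequences; it can be any individual
  that is not such a sequence.  The greatest element is \<open>emp E\<close>.
\<close>

definition tree :: "'m \<Rightarrow> 'm set" where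
  "tree \<kappa> = {p. is_fun E p \<and> (\<exists>n \<in> nats E. fdom E p = ext E n) \<and> fran E p \<subseteq> ext E \<kappa>}"

definition conditions :: "'m \<Rightarrow> 'm \<Rightarrow> 'm set" where
  "conditions zero \<kappa> = insert zero (tree \<kappa>)"

definition pmult :: "'m \<Rightarrow> 'm \<Rightarrow> 'm \<Rightarrow> 'm" where
  "pmult zero p q =
     (if p = zero \<or> q = zero then zero
      else if ext E p \<subseteq> ext E q then q
      else if ext E q \<subseteq> ext E p then p
      else zero)"

definition in_pole_B :: "'m ralg \<Rightarrow> 'm \<Rightarrow> 'm \<Rightarrow> 'm \<Rightarrow> 'm \<Rightarrow> bool" where
  "in_pole_B A zero x s p \<longleftrightarrow>
     (\<forall>n \<in> nats E. p \<noteq> zero \<and> fdom E p \<subseteq> ext E n \<longrightarrow>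
        proc A x (push A (numeral_term A n) s) \<in> pole A)"

definition alg_B :: "'m ralg \<Rightarrow> 'm \<Rightarrow> 'm \<Rightarrow> 'm ralg" where
  "alg_B A zero \<kappa> =
     (let P = conditions zero \<kappa>;
          lift = (\<lambda>f u v. opair E (f (mfst E u) (mfst E v)) (pmult zero (msnd E u) (msnd E v)))
      in \<lparr> Terms = mprod E (Terms A) P,
           Stacks = mprod E (Stacks A) P,
           Procs = mprod E (Procs A) P,
           app = lift (\<lambda>x y. app A (app A (comb A CC) x) y),
           push = lift (push A),
           proc = lift (proc A),
           kont = (\<lambda>s. opair E (starred_kont A (mfst E s)) (msnd E s)),
           comb = (\<lambda>c. opair E (cval A (starred_comb c)) (emp E)),
           pole = {opair E (proc A x s) p | x s p.
                     x \<in> Terms A \<and> s \<in> Stacks A \<and> p \<in> P \<and> in_pole_B A zero x s p} \<rparr>)"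

text \<open>
  The membership of \<open>(\<xi> \<star> \<pi>, p)\<close> in the pole is prescribed in terms of \<open>\<xi>\<close> and \<open>\<pi>\<close>.
  This makes sense only if it does not depend on the choice of \<open>\<xi>\<close> and \<open>\<pi>\<close> (automatic when
  \<open>\<star>\<close> is injective, in particular for algebras whose processes are pairs).
\<close>

definition pole_B_well_defined :: "'m ralg \<Rightarrow> 'm \<Rightarrow> 'm \<Rightarrow> bool" where
  "pole_B_well_defined A zero \<kappa> \<longleftrightarrow>
     (\<forall>x \<in> Terms A. \<forall>s \<in> Stacks A. \<forall>p \<in> conditions zero \<kappa>.
        opair E (proc A x s) p \<in> pole (alg_B A zero \<kappa>) \<longleftrightarrow> in_pole_B A zero x s p)"

definition generic_ext :: "'m ralg \<Rightarrow> 'm \<Rightarrow> 'm \<Rightarrow> 'm set" where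
  "generic_ext A zero \<kappa> =
     {opair E (opair E m a) (opair E s p) | m a s p.
        m \<in> nats E \<and> a \<^bold>\<in> \<kappa> \<and> s \<in> Stacks A \<and> p \<in> conditions zero \<kappa> - {zero} \<and>
        m \<in> fdom E p \<and> fapp E p m = a}"

end

end

theory Submission
  imports Defs
begin

text \<open>
  (i) The two conditions of a stack carrying \<open>(x, y) \<epsilon> \<G>\<close> and a stack against \<open>(x, y') \<epsilon> \<G>\<close> are
  compatible unless their product is \<open>\<zero>\<close>, and then the sequences agree at \<open>x\<close>, so \<open>y = y'\<close>.

  (ii) Given \<open>y\<close> and a condition whose domain is at most \<open>n\<close>, extend it to a sequence of length
  \<open>n + 1\<close> with value \<open>y\<close> at \<open>n\<close>. Then \<open>\<xi>\<close> may be executed against the integer \<open>n\<close> of the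
  collapsing algebra provided it is passed \<open>n + 1\<close> as length bound, and \<open>\<theta>\<^sub>1\<close> does this: the Church
  numeral \<open>n\<close>, iterating \<open>\<lambda>f. f \<circ> (C\<sigma>\<^sup>*)\<close>, produces \<open>n\<^sup>*\<close>.

  The integers may be nonstandard, so the iteration needs an induction inside the model, hence the
  calculus of definable predicates.
\<close>

section \<open>Definability with parameters\<close>

primrec rename_fm :: "(nat \<Rightarrow> nat) \<Rightarrow> fm \<Rightarrow> fm" where
  "rename_fm r (Mem i j) = Mem (r i) (r j)"
| "rename_fm r (Eq i j) = Eq (r i) (r j)"
| "rename_fm r (Neg f) = Neg (rename_fm r f)"
| "rename_fm r (Conj f g) = Conj (rename_fm r f) (rename_fm r g)"
| "rename_fm r (Forall i f) = Forall (r i) (rename_fm r f)"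

text \<open>Bound variables are renamed along with free ones; injectivity of \<open>r\<close>
  prevents capture, so that updating the environment commutes with renaming.\<close>

lemma sat_rename_fm:
  assumes "inj r"
  shows "sat E (rename_fm r f) e = sat E f (\<lambda>i. e (r i))"
proof (induction f arbitrary: e)
  case (Forall i f)
  have "(\<lambda>j. (e(r i := a)) (r j)) = (\<lambda>j. e (r j))(i := a)" for a
    using assms by (auto simp: fun_eq_iff inj_eq)
  with Forall show ?case by simp
qed auto

definition mix :: "(nat \<Rightarrow> 'm) \<Rightarrow> (nat \<Rightarrow> 'm) \<Rightarrow> nat \<Rightarrow> 'm" where
  "mix e c i = (if even i then e (i div 2) else c (i div 2))"

text \<open>
  The even variables of the formula are the arguments of the predicate, the odd ones its
  parameters. Quantifiers over predicates of environments bind variable 0 and shift the others,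
  so that the closure properties below apply by plain resolution.
\<close>

definition definable :: "('m \<Rightarrow> 'm \<Rightarrow> bool) \<Rightarrow> ((nat \<Rightarrow> 'm) \<Rightarrow> bool) \<Rightarrow> bool" where
  "definable E \<phi> \<longleftrightarrow> (\<exists>f c. \<forall>e. sat E f (mix e c) = \<phi> e)"

definition definable_term :: "('m \<Rightarrow> 'm \<Rightarrow> bool) \<Rightarrow> ((nat \<Rightarrow> 'm) \<Rightarrow> 'm) \<Rightarrow> bool" where
  "definable_term E t \<longleftrightarrow> definable E (\<lambda>e. e 0 = t (\<lambda>i. e (Suc i)))"

section \<open>Closure properties of definable predicates and terms\<close>

lemma definableI: "(\<And>e. sat E f (mix e c) = \<phi> e) \<Longrightarrow> definable E \<phi>"
  unfolding definable_def by blast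

lemma definable_rename:
  assumes "inj r" and "definable E \<phi>"
  shows "definable E (\<lambda>e. \<phi> (\<lambda>i. e (r i)))"
proof -
  obtain f c where f: "\<And>e. sat E f (mix e c) = \<phi> e"
    using assms(2) unfolding definable_def by blast
  \<comment> \<open>Arguments sit on even variables: \<open>s\<close> acts there as \<open>r\<close>
    and leaves the parameters in place.\<close>
  define s where "s i = (if even i then 2 * r (i div 2) else i)" for i
  have "inj s"
  proof (rule injI)
    fix i j assume *: "s i = s j"
    then have "even i = even j" unfolding s_def by (metis dvd_triv_left)
    with * show "i = j"
      using assms(1) unfolding s_def
      by (metis dvd_mult_div_cancel inj_eq mult_cancel1 zero_neq_numeral)
  qed
  moreover have "(\<lambda>i. mix e c (s i)) = mix (\<lambda>i. e (r i)) c" for e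
    by (auto simp: fun_eq_iff mix_def s_def)
  ultimately show ?thesis
    by (intro definableI[where f = "rename_fm s f" and c = c]) (simp add: sat_rename_fm f)
qed

lemma definable_var:
  "definable E (\<lambda>e. E (e i) (e j))" "definable E (\<lambda>e. e i = e j)"
  by (rule definableI[where f = "Mem (2*i) (2*j)"], simp add: mix_def)
     (rule definableI[where f = "Eq (2*i) (2*j)"], simp add: mix_def)

lemma definable_eq_const: "definable E (\<lambda>e. e i = c)"
  by (rule definableI[where f = "Eq (2*i) 1" and c = "\<lambda>_. c"]) (simp add: mix_def)

lemma definable_const: "definable E (\<lambda>e. P)"
  by (cases P)
    (rule definableI[where f = "Eq 0 0"], simp,
     rule definableI[where f = "Neg (Eq 0 0)"], simp)

lemma definable_neg: "definable E \<phi> \<Longrightarrow> definable E (\<lambda>e. \<not> \<phi> e)"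
  unfolding definable_def by (metis sat.simps(3))

lemma definable_conj:
  assumes "definable E \<phi>" and "definable E \<psi>"
  shows "definable E (\<lambda>e. \<phi> e \<and> \<psi> e)"
proof -
  obtain f c where f: "\<And>e. sat E f (mix e c) = \<phi> e"
    using assms(1) unfolding definable_def by blast
  obtain g d where g: "\<And>e. sat E g (mix e d) = \<psi> e"
    using assms(2) unfolding definable_def by blast
  \<comment> \<open>The two formulas have separate parameter sequences, which \<open>b\<close>
    interleaves: the \<open>k\<close>-th parameter of \<open>f\<close> moves from variable
    \<open>2 * k + 1\<close> to \<open>4 * k + 1\<close>, that of \<open>g\<close> to
    \<open>4 * k + 3\<close>.\<close>
  define r where "r i = (if even i then i else 4 * (i div 2) + 1)" for i :: nat
  define s where "s i = (if even i then i else 4 * (i div 2) + 3)" for i :: nat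
  define b where "b i = (if even i then c (i div 2) else d (i div 2))" for i
  have "inj r" "inj s"
    unfolding r_def s_def inj_def by (auto split: if_splits elim!: evenE oddE) presburger+
  moreover have "mix e b (r i) = mix e c i" "mix e b (s i) = mix e d i" for e i
  proof -
    have "odd ((4 * k + 3) div 2) \<and> (4 * k + 3) div 2 div 2 = k"
      and "(4 * k + 1) div 2 div 2 = k \<and> even ((4 * k + 1) div 2)" for k :: nat
      by presburger+
    moreover have "odd i \<Longrightarrow> (i - Suc 0) div 2 = i div 2" by presburger
    ultimately show "mix e b (r i) = mix e c i" "mix e b (s i) = mix e d i"
      by (simp_all only: mix_def r_def s_def b_def) simp_all
  qed
  ultimately show ?thesis
    by (intro definableI[where f = "Conj (rename_fm r f) (rename_fm s g)" and c = b])
      (simp add: sat_rename_fm f g)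
qed

lemma definable_all:
  assumes "definable E (\<lambda>e. P (\<lambda>i. e (Suc i)) (e 0))"
  shows "definable E (\<lambda>e. \<forall>a. P e a)"
proof -
  obtain f c where f: "\<And>e. sat E f (mix e c) = P (\<lambda>i. e (Suc i)) (e 0)"
    using assms(1) unfolding definable_def by blast
  \<comment> \<open>The argument to be bound moves to the odd variable 1, the other arguments drop
    by two, and the parameters rise by two to vacate that place. The quantifier overwrites variable
    1, hence the arbitrary \<open>undefined\<close> below.\<close>
  define r where "r i = (if i = 0 then 1 else if even i then i - 2 else i + 2)" for i :: nat
  have "inj r"
    unfolding r_def inj_def by (auto split: if_splits) presburger+
  moreover have "(\<lambda>i. ((mix e (case_nat d c))(Suc 0 := a)) (r i)) = mix (case_nat a e) c" for e a d
  proof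
    fix i
    consider "i = 0" | j where "i = 2 * Suc j" | j where "i = 2 * j + 1"
      by (metis Suc_eq_plus1 evenE mult_0_right not0_implies_Suc oddE)
    then show "((mix e (case_nat d c))(Suc 0 := a)) (r i) = mix (case_nat a e) c i"
      by cases (auto simp: r_def mix_def)
  qed
  ultimately show ?thesis
    by (intro definableI[where f = "Forall 1 (rename_fm r f)" and c = "case_nat undefined c"])
      (simp add: sat_rename_fm f)
qed

lemma definable_connectives:
  assumes "definable E \<phi>" and "definable E \<psi>"
  shows "definable E (\<lambda>e. \<phi> e \<or> \<psi> e)"
    and "definable E (\<lambda>e. \<phi> e \<longrightarrow> \<psi> e)"
    and "definable E (\<lambda>e. \<phi> e \<longleftrightarrow> \<psi> e)"
proof -
  have "(\<lambda>e. \<phi> e \<or> \<psi> e) = (\<lambda>e. \<not> (\<not> \<phi> e \<and> \<not> \<psi> e))"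
    and "(\<lambda>e. \<phi> e \<longrightarrow> \<psi> e) = (\<lambda>e. \<not> (\<phi> e \<and> \<not> \<psi> e))"
    and "(\<lambda>e. \<phi> e \<longleftrightarrow> \<psi> e) = (\<lambda>e. \<not> (\<phi> e \<and> \<not> \<psi> e) \<and> \<not> (\<psi> e \<and> \<not> \<phi> e))"
    by blast+
  then show "definable E (\<lambda>e. \<phi> e \<or> \<psi> e)" "definable E (\<lambda>e. \<phi> e \<longrightarrow> \<psi> e)"
    "definable E (\<lambda>e. \<phi> e \<longleftrightarrow> \<psi> e)"
    using assms by (simp_all only:) (intro definable_neg definable_conj; assumption)+
qed

lemma definable_ex:
  assumes "definable E (\<lambda>e. P (\<lambda>i. e (Suc i)) (e 0))"
  shows "definable E (\<lambda>e. \<exists>a. P e a)"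
proof -
  have "definable E (\<lambda>e. \<not> (\<forall>a. \<not> P e a))"
    by (intro definable_neg definable_all assms)
  then show ?thesis by simp
qed

text \<open>Formulas have no function symbols, so a term enters through its graph, with an
  existential quantifier over its value.\<close>

lemma definable_subst:
  assumes "definable_term E t" and "definable E (\<lambda>e. P (e 0) (\<lambda>i. e (Suc i)))"
  shows "definable E (\<lambda>e. P (t e) e)"
proof -
  have "definable E (\<lambda>e. \<exists>v. v = t e \<and> P v e)"
    using assms unfolding definable_term_def
    by (intro definable_ex definable_conj)
  then show ?thesis by simp
qed

lemma definable_term_shift:
  assumes "definable_term E t"
  shows "definable_term E (\<lambda>e. t (\<lambda>i. e (Suc i)))"
proof -
  have "inj (case_nat 0 (\<lambda>i. Suc (Suc i)))"
    by (auto simp: inj_def split: nat.splits)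
  from definable_rename[OF this assms[unfolded definable_term_def]]
  show ?thesis unfolding definable_term_def by simp
qed

lemma definable_pred2:
  assumes "definable E (\<lambda>e. R (e 0) (e (Suc 0)))" and "definable_term E t" and "definable_term E u"
  shows "definable E (\<lambda>e. R (t e) (u e))"
proof (rule definable_subst[OF assms(2), where P = "\<lambda>v e. R v (u e)"])
  \<comment> \<open>Exchanging variables 0 and 1 puts the second argument where
    \<open>definable_subst\<close> can replace it; the outer substitution handles the first.\<close>
  have "inj (case_nat (Suc 0) (case_nat 0 (\<lambda>i. Suc (Suc i))))"
    by (auto simp: inj_def split: nat.splits)
  from definable_rename[OF this assms(1)]
  have "definable E (\<lambda>e. R (e (Suc 0)) (e 0))" by simp
  then show "definable E (\<lambda>e. R (e 0) (u (\<lambda>i. e (Suc i))))"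
    by (intro definable_subst[OF definable_term_shift[OF assms(3)], where P = "\<lambda>v e. R (e 0) v"])
qed

lemma definable_term_fun2:
  assumes F: "definable E (\<lambda>e. e 0 = F (e (Suc 0)) (e (Suc (Suc 0))))"
    and t: "definable_term E t" and u: "definable_term E u"
  shows "definable_term E (\<lambda>e. F (t e) (u e))"
  unfolding definable_term_def
proof (rule definable_subst[OF definable_term_shift[OF t],
      where P = "\<lambda>v e. e 0 = F v (u (\<lambda>i. e (Suc i)))"])
  \<comment> \<open>The value of \<open>F\<close> gives up variable 0, which the substitutions of
    \<open>u\<close> and \<open>t\<close> consume in turn.\<close>
  have "inj (\<lambda>i. if i = 0 then Suc (Suc 0) else if i = 1 then 1 else if i = 2 then 0 else i)"
    by (auto simp: inj_def split: if_splits)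
  from definable_rename[OF this F]
  have "definable E (\<lambda>e. e (Suc (Suc 0)) = F (e (Suc 0)) (e 0))" by simp
  then have "definable E (\<lambda>e. e (Suc 0) = F (e 0) (u (\<lambda>i. e (Suc (Suc i)))))"
    by (intro definable_subst[OF definable_term_shift[OF definable_term_shift[OF u]],
          where P = "\<lambda>v e. e (Suc 0) = F (e 0) v"])
  then show "definable E (\<lambda>e. e (Suc 0) = F (e 0) (u (\<lambda>i. e (Suc (Suc i)))))" .
qed

lemma definable_term_var: "definable_term E (\<lambda>e. e i)"
  unfolding definable_term_def by (rule definable_var)

lemma definable_term_const: "definable_term E (\<lambda>e. c)"
  unfolding definable_term_def by (rule definable_eq_const)

lemma definable_atom:
  assumes "definable_term E t" and "definable_term E u"
  shows "definable E (\<lambda>e. E (t e) (u e))" and "definable E (\<lambda>e. t e = u e)"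
  by (rule definable_pred2[where R = E, OF definable_var(1) assms])
     (rule definable_pred2[where R = "(=)", OF definable_var(2) assms])

lemma definable_mem:
  assumes "is_set E X" and "definable_term E t"
  shows "definable E (\<lambda>e. t e \<in> X)"
proof -
  obtain x where "ext E x = X" using assms(1) unfolding is_set_def by blast
  moreover have "definable E (\<lambda>e. E (t e) x)"
    by (intro definable_atom assms definable_term_const)
  ultimately show ?thesis unfolding ext_def by auto
qed

lemma definable_bounded:
  assumes "is_set E X" and P: "definable E (\<lambda>e. P (\<lambda>i. e (Suc i)) (e 0))"
  shows "definable E (\<lambda>e. \<forall>a\<in>X. P e a)" and "definable E (\<lambda>e. \<exists>a\<in>X. P e a)"
  unfolding Ball_def Bex_def
  by (intro definable_all definable_ex definable_connectives definable_conj P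
      definable_mem[OF assms(1)] definable_term_var)+

lemmas definable_intros =
  definable_neg definable_conj definable_connectives definable_all definable_ex definable_atom
  definable_mem definable_bounded definable_term_var definable_term_const

section \<open>Set theory inside a model\<close>

text \<open>
  An internal function is only given on its domain; these total extensions of it are definable.
\<close>

definition restr :: "'m set \<Rightarrow> ('m \<Rightarrow> 'm) \<Rightarrow> 'm \<Rightarrow> 'm" where
  "restr X h x = (if x \<in> X then h x else x)"

definition restr2 :: "'m set \<Rightarrow> 'm set \<Rightarrow> ('m \<Rightarrow> 'm \<Rightarrow> 'm) \<Rightarrow> 'm \<Rightarrow> 'm \<Rightarrow> 'm" where
  "restr2 X Y h x y = (if x \<in> X \<and> y \<in> Y then h x y else x)"

lemma restr_simps [simp]:
  "x \<in> X \<Longrightarrow> restr X h x = h x"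
  "x \<in> X \<Longrightarrow> y \<in> Y \<Longrightarrow> restr2 X Y k x y = k x y"
  by (simp_all add: restr_def restr2_def)

locale zf_model =
  fixes E :: "'m \<Rightarrow> 'm \<Rightarrow> bool"
  assumes ZF: "ZF_model E"
begin

lemma mem_ext [simp]: "z \<in> ext E x \<longleftrightarrow> E z x"
  by (simp add: ext_def)

lemmas ZF_axioms = ZF[unfolded ZF_model_def]

lemma extensionality: "ext E x = ext E y \<Longrightarrow> x = y"
  using conjunct1[OF ZF_axioms] by blast

lemma foundation: "E z x \<Longrightarrow> \<exists>y. E y x \<and> ext E x \<inter> ext E y = {}"
  using conjunct1[OF conjunct2[OF ZF_axioms]] by auto

lemma pairing: "is_set E {x, y}"
  using conjunct1[OF conjunct2[OF conjunct2[OF ZF_axioms]]] unfolding is_set_def by blast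

lemma union: "is_set E {w. \<exists>y. E y x \<and> E w y}"
  using conjunct1[OF conjunct2[OF conjunct2[OF conjunct2[OF ZF_axioms]]]]
  unfolding is_set_def by blast

lemma infinity: "\<exists>w. is_inductive E w"
  using ZF_axioms by (elim conjE)

lemma is_set_ext [simp]: "is_set E (ext E x)"
  unfolding is_set_def by blast

lemma is_setE: assumes "is_set E X" obtains x where "ext E x = X"
  using assms unfolding is_set_def by blast

lemma the_ext: "ext E z = X \<Longrightarrow> (THE z. ext E z = X) = z"
  by (auto intro: extensionality)

lemma ext_the: "is_set E X \<Longrightarrow> ext E (THE z. ext E z = X) = X"
  using the_ext by (metis is_setE)

lemma replacement:
  assumes R: "definable E (\<lambda>e. R (e 0) (e (Suc 0)))" and X: "is_set E X"
    and functional: "\<And>x y y'. x \<in> X \<Longrightarrow> R x y \<Longrightarrow> R x y' \<Longrightarrow> y = y'"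
  shows "is_set E {y. \<exists>x\<in>X. R x y}"
proof -
  obtain f c where f: "\<And>e. sat E f (mix e c) = R (e 0) (e (Suc 0))"
    using R unfolding definable_def by blast
  obtain a where a: "ext E a = X" using X by (rule is_setE)
  \<comment> \<open>The replacement scheme expects \<open>x\<close> and \<open>y\<close> in
    variables 0 and 1, which are the even variables 0 and 2 of \<open>f\<close>. All others move up
    by two, where \<open>e\<close> keeps the parameters.\<close>
  define r where "r i = (if i = 0 then 0 else if i = 2 then 1 else i + 2)" for i :: nat
  have "inj r" unfolding r_def inj_def by auto
  define e where "e i = mix (\<lambda>_. undefined) c (i - 2)" for i
  have "(\<lambda>i. (e(0 := x, 1 := y)) (r i)) = mix ((\<lambda>_. undefined)(0 := x, Suc 0 := y)) c" for x y
  proof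
    fix i :: nat
    consider "i = 0" | "i = 2" | "i \<noteq> 0" "i \<noteq> 2" by blast
    then show "(e(0 := x, 1 := y)) (r i) = mix ((\<lambda>_. undefined)(0 := x, Suc 0 := y)) c i"
      by cases (auto simp: r_def e_def mix_def elim!: evenE)
  qed
  then have sat: "sat E (rename_fm r f) (e(0 := x, 1 := y)) = R x y" for x y
    unfolding sat_rename_fm[OF \<open>inj r\<close>] by (simp add: f)
  have "\<forall>f e a. (\<forall>x y y'. E x a \<and> sat E f (e(0 := x, 1 := y)) \<and> sat E f (e(0 := x, 1 := y')) \<longrightarrow> y = y')
      \<longrightarrow> (\<exists>b. ext E b = {y. \<exists>x. E x a \<and> sat E f (e(0 := x, 1 := y))})"
    using ZF_axioms by (elim conjE)
  from this[rule_format, of a "rename_fm r f" e]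
  have "\<exists>b. ext E b = {y. \<exists>x. E x a \<and> R x y}"
    unfolding sat using functional a by fastforce
  then show ?thesis using a unfolding is_set_def by (auto simp: Bex_def simp flip: mem_ext)
qed

text \<open>Replacement along the identity restricted to \<open>P\<close>.\<close>

lemma separation:
  assumes "definable E (\<lambda>e. P (e 0))" and "is_set E X"
  shows "is_set E {x \<in> X. P x}"
proof -
  have "is_set E {y. \<exists>x\<in>X. P x \<and> y = x}"
    using assms by (intro replacement definable_intros) auto
  moreover have "{y. \<exists>x\<in>X. P x \<and> y = x} = {x \<in> X. P x}" by blast
  ultimately show ?thesis by simp
qed

lemma is_set_image:
  assumes "definable_term E (\<lambda>e. h (e 0))" and "is_set E X"
  shows "is_set E (h ` X)"
proof -
  have "inj (case_nat (Suc 0) (case_nat 0 (\<lambda>i. Suc (Suc i))))"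
    by (auto simp: inj_def split: nat.splits)
  from definable_rename[OF this assms(1)[unfolded definable_term_def]]
  have "definable E (\<lambda>e. e (Suc 0) = h (e 0))" by simp
  then have "is_set E {y. \<exists>x\<in>X. y = h x}"
    using assms(2) by (intro replacement) auto
  then show ?thesis by (simp add: image_def)
qed

lemma is_set_Union:
  assumes "is_set E (X :: 'm set)"
  shows "is_set E (\<Union>x\<in>X. ext E x)"
proof -
  obtain x where "ext E x = X" using assms by (rule is_setE)
  then have "(\<Union>x\<in>X. ext E x) = {w. \<exists>y. E y x \<and> E w y}" by auto
  then show ?thesis using union by simp
qed

lemma is_set_Un:
  assumes "is_set E X" and "is_set E Y"
  shows "is_set E (X \<union> Y)"
proof -
  obtain x y where "ext E x = X" "ext E y = Y" using assms by (metis is_setE)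
  then have "X \<union> Y = (\<Union>x\<in>{x, y}. ext E x)" by simp
  then show ?thesis using is_set_Union[OF pairing] by simp
qed

lemma ext_emp [simp]: "ext E (emp E) = {}"
proof -
  have "is_set E {x \<in> ext E undefined. False}"
    by (intro separation definable_const is_set_ext)
  then show ?thesis unfolding emp_def by (intro ext_the) simp
qed

lemma ext_upair [simp]: "ext E (upair E x y) = {x, y}"
  unfolding upair_def by (intro ext_the pairing)

lemma ext_succ [simp]: "ext E (succ E x) = insert x (ext E x)"
proof -
  have "is_set E ({x, x} \<union> ext E x)" by (intro is_set_Un pairing is_set_ext)
  then show ?thesis unfolding succ_def by (intro ext_the) simp
qed

lemma mem_simps [simp]:
  "\<not> E x (emp E)"
  "E z (upair E x y) \<longleftrightarrow> z = x \<or> z = y"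
  "E z (succ E x) \<longleftrightarrow> z = x \<or> E z x"
  by (simp_all flip: mem_ext)

lemma eq_iff_mem: "x = y \<longleftrightarrow> (\<forall>z. E z x \<longleftrightarrow> E z y)"
  by (metis extensionality mem_ext set_eqI)

lemma upair_inj: "upair E x y = upair E x' y' \<longleftrightarrow> {x, y} = {x', y'}"
  by (metis ext_upair extensionality)

lemma opair_inj [simp]: "opair E x y = opair E x' y' \<longleftrightarrow> x = x' \<and> y = y'"
  unfolding opair_def upair_inj doubleton_eq_iff by auto

lemma mfst_opair [simp]: "mfst E (opair E x y) = x"
  and msnd_opair [simp]: "msnd E (opair E x y) = y"
  unfolding mfst_def msnd_def by auto

lemma definable_term_upair:
  assumes "definable_term E t" and "definable_term E u"
  shows "definable_term E (\<lambda>e. upair E (t e) (u e))"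
proof (rule definable_term_fun2[OF _ assms])
  have "definable E (\<lambda>e. \<forall>z. E z (e 0) \<longleftrightarrow> z = e (Suc 0) \<or> z = e (Suc (Suc 0)))"
    by (intro definable_intros)
  then show "definable E (\<lambda>e. e 0 = upair E (e (Suc 0)) (e (Suc (Suc 0))))"
    unfolding eq_iff_mem[of _ "upair E _ _"] by simp
qed

lemma definable_term_opair:
  assumes "definable_term E t" and "definable_term E u"
  shows "definable_term E (\<lambda>e. opair E (t e) (u e))"
  unfolding opair_def by (intro definable_term_upair assms)

lemma definable_term_succ:
  assumes "definable_term E t"
  shows "definable_term E (\<lambda>e. succ E (t e))"
proof (rule definable_term_fun2[where F = "\<lambda>x _. succ E x", OF _ assms assms])
  have "definable E (\<lambda>e. \<forall>z. E z (e 0) \<longleftrightarrow> z = e (Suc 0) \<or> E z (e (Suc 0)))"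
    by (intro definable_intros)
  then show "definable E (\<lambda>e. e 0 = succ E (e (Suc 0)))"
    unfolding eq_iff_mem[of _ "succ E _"] by simp
qed

lemma definable_term_restr2:
  assumes X: "is_set E X" and Y: "is_set E Y"
    and G: "is_set E {opair E (opair E x y) (h x y) | x y. x \<in> X \<and> y \<in> Y}" (is "is_set E ?G")
    and "definable_term E t" and "definable_term E u"
  shows "definable_term E (\<lambda>e. restr2 X Y h (t e) (u e))"
proof (rule definable_term_fun2[OF _ assms(4,5)])
  \<comment> \<open>The graph of \<open>h\<close> is a set only over \<open>X\<close> and
    \<open>Y\<close>; the second disjunct describes the default value, the first argument.\<close>
  have "definable E (\<lambda>e. opair E (opair E (e (Suc 0)) (e (Suc (Suc 0)))) (e 0) \<in> ?G \<or>
      \<not> (e (Suc 0) \<in> X \<and> e (Suc (Suc 0)) \<in> Y) \<and> e 0 = e (Suc 0))"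
    by (intro definable_intros X Y G definable_term_opair)
  then show "definable E (\<lambda>e. e 0 = restr2 X Y h (e (Suc 0)) (e (Suc (Suc 0))))"
    by (rule back_subst[where P = "definable E"]) (auto simp: restr2_def fun_eq_iff)
qed

lemma definable_term_restr:
  assumes X: "is_set E X" and G: "is_set E ((\<lambda>x. opair E x (h x)) ` X)"
    and "definable_term E t"
  shows "definable_term E (\<lambda>e. restr X h (t e))"
proof (rule definable_term_fun2[where F = "\<lambda>x _. restr X h x", OF _ assms(3,3)])
  have "definable E (\<lambda>e. opair E (e (Suc 0)) (e 0) \<in> (\<lambda>x. opair E x (h x)) ` X \<or>
      e (Suc 0) \<notin> X \<and> e 0 = e (Suc 0))"
    by (intro definable_intros X G definable_term_opair)
  then show "definable E (\<lambda>e. e 0 = restr X h (e (Suc 0)))"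
    by (rule back_subst[where P = "definable E"]) (auto simp: restr_def fun_eq_iff)
qed

lemmas definable_set_intros =
  definable_intros definable_term_opair definable_term_succ definable_term_restr2
  definable_term_restr

text \<open>For fixed \<open>x\<close>, replacement gives the slice of pairs starting with
  \<open>x\<close>; a second replacement collects the slices, and their union is the
  product.\<close>

lemma is_set_mprod:
  assumes X: "is_set E X" and Y: "is_set E Y"
  shows "is_set E (mprod E X Y)"
proof -
  have "\<exists>z. ext E z = opair E x ` Y" for x
    using is_set_image[of "opair E x", OF _ Y] unfolding is_set_def
    by (simp add: definable_term_opair definable_term_var definable_term_const)
  then obtain slice where slice: "\<And>x. ext E (slice x) = opair E x ` Y" by metis
  have "definable E (\<lambda>e. \<forall>w. E w (e (Suc 0)) \<longleftrightarrow> (\<exists>y\<in>Y. w = opair E (e 0) y))"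
    by (intro definable_set_intros Y)
  also have "(\<lambda>e. \<forall>w. E w (e (Suc 0)) \<longleftrightarrow> (\<exists>y\<in>Y. w = opair E (e 0) y)) =
      (\<lambda>e. e (Suc 0) = slice (e 0))"
    unfolding eq_iff_mem[of _ "slice _"] using slice by (auto simp: set_eq_iff fun_eq_iff)
  finally have "is_set E {y. \<exists>x\<in>X. y = slice x}"
    by (intro replacement X) auto
  then have "is_set E (\<Union>y\<in>{y. \<exists>x\<in>X. y = slice x}. ext E y)" by (rule is_set_Union)
  moreover have "(\<Union>y\<in>{y. \<exists>x\<in>X. y = slice x}. ext E y) = mprod E X Y"
    unfolding mprod_def using slice by (auto simp: set_eq_iff)
  ultimately show ?thesis by simp
qed

section \<open>Natural numbers of the model\<close>

lemma is_inductive_iff: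
  "is_inductive E w \<longleftrightarrow> E (emp E) w \<and> (\<forall>x. E x w \<longrightarrow> E (succ E x) w)"
  unfolding is_inductive_def by (metis ext_emp ext_succ extensionality)

lemma emp_nats [simp]: "emp E \<in> nats E"
  and succ_nats [simp]: "n \<in> nats E \<Longrightarrow> succ E n \<in> nats E"
  unfolding nats_def by (auto simp: is_inductive_iff)

lemma is_set_nats: "is_set E (nats E)"
proof -
  obtain w where w: "is_inductive E w" using infinity by blast
  have "is_set E {n \<in> ext E w. \<forall>v. is_inductive E v \<longrightarrow> E n v}"
    unfolding is_inductive_iff by (intro separation definable_set_intros is_set_ext)
  moreover have "{n \<in> ext E w. \<forall>v. is_inductive E v \<longrightarrow> E n v} = nats E"
    using w unfolding nats_def by auto
  ultimately show ?thesis by simp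
qed

text \<open>With nonstandard integers around, induction needs a definable \<open>P\<close>:
  separation makes the set of good integers internal, and being inductive it contains all of
  \<open>nats\<close>.\<close>

lemma internal_induct:
  assumes "n \<in> nats E" and "definable E (\<lambda>e. P (e 0))" and "P (emp E)"
    and "\<And>k. k \<in> nats E \<Longrightarrow> P k \<Longrightarrow> P (succ E k)"
  shows "P n"
proof -
  obtain w where w: "ext E w = {k \<in> nats E. P k}"
    using separation[OF assms(2) is_set_nats] by (rule is_setE)
  then have *: "E k w \<longleftrightarrow> k \<in> nats E \<and> P k" for k by (auto simp flip: mem_ext)
  have "is_inductive E w" unfolding is_inductive_iff * using assms by auto
  then have "E n w" using assms(1) unfolding nats_def by blast
  then show ?thesis using * by blast
qed

lemma mem_irrefl: "\<not> E x x"
  using foundation[of x "upair E x x"] by auto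

lemma mem_asym: "E x y \<Longrightarrow> \<not> E y x"
  using foundation[of x "upair E x y"] by auto

lemma succ_inj: "succ E x = succ E y \<Longrightarrow> x = y"
  using mem_asym by (metis mem_simps(3))

lemma succ_ne_emp: "succ E x \<noteq> emp E"
  by (metis mem_simps(1,3))

lemma mem_nats:
  assumes "n \<in> nats E" shows "E k n \<Longrightarrow> k \<in> nats E"
proof -
  have "\<forall>k. E k n \<longrightarrow> k \<in> nats E"
    by (rule internal_induct[OF assms]) (auto intro!: definable_set_intros is_set_nats)
  then show "E k n \<Longrightarrow> k \<in> nats E" by blast
qed

lemma mem_nats_trans:
  assumes "n \<in> nats E" shows "E j k \<Longrightarrow> E k n \<Longrightarrow> E j n"
proof -
  have "\<forall>k. E k n \<longrightarrow> (\<forall>j. E j k \<longrightarrow> E j n)"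
    by (rule internal_induct[OF assms]) (auto intro!: definable_set_intros)
  then show "E j k \<Longrightarrow> E k n \<Longrightarrow> E j n" by blast
qed

lemma succ_mem_succ_iff:
  assumes "n \<in> nats E" shows "E (succ E k) (succ E n) \<longleftrightarrow> E k n"
proof
  have "\<forall>k. E k n \<longrightarrow> E (succ E k) (succ E n)"
    by (rule internal_induct[OF assms]) (intro definable_set_intros, auto)
  then show "E k n \<Longrightarrow> E (succ E k) (succ E n)" by blast
  show "E (succ E k) (succ E n) \<Longrightarrow> E k n"
    using mem_nats_trans[OF assms, of k "succ E k"] by auto
qed

section \<open>Iteration and recursion along the integers of the model\<close>

lemma fapp_eqI: "is_fun E f \<Longrightarrow> E (opair E x y) f \<Longrightarrow> fapp E f x = y"
  unfolding is_fun_def fapp_def by blast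

lemma mem_fapp: "is_fun E f \<Longrightarrow> x \<in> fdom E f \<Longrightarrow> E (opair E x (fapp E f x)) f"
  unfolding fdom_def by (auto dest: fapp_eqI)

text \<open>Internal induction shows that every approximation in the definition of
  \<open>iter\<close> agrees with \<open>h\<close>, and the graph of \<open>h\<close> cut down to
  \<open>succ E n\<close> is one. Definability enters through \<open>h\<close> only, so
  \<open>f\<close> may be any operation.\<close>

lemma iter_eqI:
  assumes graph: "is_set E ((\<lambda>n. opair E n (h n)) ` nats E)" and h0: "h (emp E) = a"
    and hsucc: "\<And>k. k \<in> nats E \<Longrightarrow> h (succ E k) = f (h k)" and n: "n \<in> nats E"
  shows "iter E f a n = h n"
proof -
  let ?approx = "\<lambda>g. is_fun E g \<and> fdom E g = ext E (succ E n) \<and> fapp E g (emp E) = a \<and>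
    (\<forall>k. E k n \<longrightarrow> fapp E g (succ E k) = f (fapp E g k))"
  have dom_nats: "k \<in> nats E" if "E k (succ E n)" for k
    using mem_nats[OF succ_nats[OF n] that] .
  have emp_dom: "E (emp E) (succ E n)"
    by (rule internal_induct[OF n]) (intro definable_set_intros, auto)
  have unique: "fapp E g n = h n" if g: "?approx g" for g
  proof -
    have dom: "E (opair E k (fapp E g k)) g" if "E k (succ E n)" for k
      using g that by (intro mem_fapp) auto
    \<comment> \<open>Membership in \<open>g\<close> and \<open>restr\<close> keep the predicate
      definable; the guard confines the induction, which runs over all integers, to the domain of
      \<open>g\<close>.\<close>
    have "E n (succ E n) \<longrightarrow> E (opair E n (restr (nats E) h n)) g"
    proof (rule internal_induct[OF n, where P =
          "\<lambda>k. E k (succ E n) \<longrightarrow> E (opair E k (restr (nats E) h k)) g"])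
      show "definable E (\<lambda>e. E (e 0) (succ E n) \<longrightarrow> E (opair E (e 0) (restr (nats E) h (e 0))) g)"
        by (intro definable_set_intros is_set_nats graph)
      show "E (emp E) (succ E n) \<longrightarrow> E (opair E (emp E) (restr (nats E) h (emp E))) g"
        using dom[OF emp_dom] g h0 by simp
    next
      fix k assume k: "k \<in> nats E" and IH: "E k (succ E n) \<longrightarrow> E (opair E k (restr (nats E) h k)) g"
      show "E (succ E k) (succ E n) \<longrightarrow> E (opair E (succ E k) (restr (nats E) h (succ E k))) g"
      proof
        assume *: "E (succ E k) (succ E n)"
        then have "E k n" using succ_mem_succ_iff[OF n] by blast
        moreover from this have "fapp E g k = h k" using IH g k by (auto intro: fapp_eqI)
        ultimately show "E (opair E (succ E k) (restr (nats E) h (succ E k))) g"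
          using dom[OF *] g k by (simp add: hsucc)
      qed
    qed
    then show ?thesis using g n by (auto intro: fapp_eqI)
  qed
  have "is_set E ((\<lambda>k. opair E k (restr (nats E) h k)) ` ext E (succ E n))"
    by (intro is_set_image definable_set_intros is_set_nats graph is_set_ext)
  also have "(\<lambda>k. opair E k (restr (nats E) h k)) ` ext E (succ E n) =
      (\<lambda>k. opair E k (h k)) ` ext E (succ E n)"
    using dom_nats by (intro image_cong) (auto simp del: ext_succ)
  finally obtain g where g_def: "ext E g = (\<lambda>k. opair E k (h k)) ` ext E (succ E n)"
    by (rule is_setE)
  have g: "E z g \<longleftrightarrow> (\<exists>k. E k (succ E n) \<and> z = opair E k (h k))" for z
    using g_def unfolding set_eq_iff image_iff Bex_def mem_ext by blast
  have "is_fun E g" unfolding is_fun_def g by auto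
  then have app: "fapp E g k = h k" if "E k (succ E n)" for k
    using that by (auto intro!: fapp_eqI simp: g)
  have "?approx g"
    using \<open>is_fun E g\<close> app[OF emp_dom] h0 app hsucc dom_nats succ_mem_succ_iff[OF n]
    by (auto simp: fdom_def g)
  then show ?thesis
    unfolding iter_def using unique by (intro the_equality) blast+
qed

text \<open>The graph \<open>H\<close> is the least set containing the initial pair and closed under
  the step; minimality makes it functional.\<close>

lemma recursion:
  assumes T: "is_set E T" and graph: "is_set E ((\<lambda>x. opair E x (f x)) ` T)"
    and a: "a \<in> T" and f: "\<And>x. x \<in> T \<Longrightarrow> f x \<in> T"
  shows "\<exists>h. is_set E ((\<lambda>n. opair E n (h n)) ` nats E) \<and> h (emp E) = a \<and>
    (\<forall>n\<in>nats E. h n \<in> T \<and> h (succ E n) = f (h n))"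
proof -
  \<comment> \<open>\<open>restr T f\<close> coincides with \<open>f\<close> on \<open>T\<close> and
    makes closedness definable.\<close>
  define closed where "closed R \<longleftrightarrow> E (opair E (emp E) a) R \<and>
    (\<forall>n\<in>nats E. \<forall>x\<in>T. E (opair E n x) R \<longrightarrow> E (opair E (succ E n) (restr T f x)) R)" for R
  have closed: "definable E (\<lambda>e. closed (e i))" for i
    unfolding closed_def by (intro definable_set_intros T graph is_set_nats)
  have "is_set E {z \<in> mprod E (nats E) T. \<forall>R. closed R \<longrightarrow> E z R}"
    by (intro separation definable_set_intros closed is_set_mprod is_set_nats T)
  then obtain H where H: "ext E H = {z \<in> mprod E (nats E) T. \<forall>R. closed R \<longrightarrow> E z R}"
    by (rule is_setE)
  have H_iff: "E z H \<longleftrightarrow> (\<exists>n x. z = opair E n x \<and> n \<in> nats E \<and> x \<in> T) \<and> (\<forall>R. closed R \<longrightarrow> E z R)" for z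
    using H unfolding set_eq_iff mem_ext mem_Collect_eq mprod_def by blast
  have H_least: "E z R" if "E z H" "closed R" for z R
    using that unfolding H_iff by blast
  have H_dom: "n \<in> nats E \<and> x \<in> T" if "E (opair E n x) H" for n x
    using that unfolding H_iff by auto
  have H_emp: "E (opair E (emp E) a) H"
    using a unfolding H_iff closed_def by auto
  have H_succ: "E (opair E (succ E n) (f x)) H" if "E (opair E n x) H" for n x
  proof -
    have "n \<in> nats E" "x \<in> T" using H_dom that by auto
    moreover have "E (opair E (succ E n) (f x)) R" if "closed R" for R
      using H_least[OF \<open>E (opair E n x) H\<close> that] that calculation unfolding closed_def by fastforce
    ultimately show ?thesis unfolding H_iff using f by auto
  qed
  \<comment> \<open>An element of any other form could be removed from \<open>H\<close>, leaving a
    smaller closed set.\<close>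
  have H_minimal: "z = opair E (emp E) a \<or> (\<exists>n x. E (opair E n x) H \<and> z = opair E (succ E n) (f x))"
    if "E z H" for z
  proof (rule ccontr)
    assume z: "\<not> ?thesis"
    have "is_set E {w \<in> ext E H. w \<noteq> z}"
      by (intro separation definable_set_intros is_set_ext)
    then obtain R where "ext E R = {w \<in> ext E H. w \<noteq> z}" by (rule is_setE)
    then have R: "E w R \<longleftrightarrow> E w H \<and> w \<noteq> z" for w
      unfolding set_eq_iff mem_ext mem_Collect_eq by blast
    have "closed R" unfolding closed_def R using H_emp H_succ z by auto
    from H_least[OF that this] show False by (simp add: R)
  qed
  have ex1: "\<exists>x. E (opair E n x) H \<and> (\<forall>y. E (opair E n y) H \<longrightarrow> y = x)" if "n \<in> nats E" for n
  proof (rule internal_induct[OF that])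
    show "definable E (\<lambda>e. \<exists>x. E (opair E (e 0) x) H \<and> (\<forall>y. E (opair E (e 0) y) H \<longrightarrow> y = x))"
      by (intro definable_set_intros)
    show "\<exists>x. E (opair E (emp E) x) H \<and> (\<forall>y. E (opair E (emp E) y) H \<longrightarrow> y = x)"
      using H_emp H_minimal by (metis opair_inj succ_ne_emp)
    fix k assume "\<exists>x. E (opair E k x) H \<and> (\<forall>y. E (opair E k y) H \<longrightarrow> y = x)"
    then obtain x where x: "E (opair E k x) H" "\<And>y. E (opair E k y) H \<Longrightarrow> y = x" by blast
    have "y = f x" if "E (opair E (succ E k) y) H" for y
      using H_minimal[OF that] x(2) succ_ne_emp[of k] by (auto dest: succ_inj)
    with H_succ[OF x(1)]
    show "\<exists>x. E (opair E (succ E k) x) H \<and> (\<forall>y. E (opair E (succ E k) y) H \<longrightarrow> y = x)"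
      by blast
  qed
  then obtain h where h: "\<And>n x. n \<in> nats E \<Longrightarrow> E (opair E n x) H \<longleftrightarrow> x = h n" by metis
  have "(\<lambda>n. opair E n (h n)) ` nats E = ext E H"
  proof (intro equalityI subsetI)
    fix z assume "z \<in> ext E H"
    then have z: "E z H" by simp
    then obtain n x where "z = opair E n x" "n \<in> nats E" unfolding H_iff by blast
    with z h show "z \<in> (\<lambda>n. opair E n (h n)) ` nats E" by auto
  qed (use h in auto)
  moreover have "h (emp E) = a" using H_emp h by auto
  moreover have "h n \<in> T \<and> h (succ E n) = f (h n)" if "n \<in> nats E" for n
    using that h H_succ H_dom by (metis succ_nats)
  ultimately show ?thesis using is_set_ext[of H] by (intro exI[of _ h]) auto
qed

text \<open>The function built by \<open>recursion\<close> has an internal graph, so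
  \<open>iter_eqI\<close> identifies it with \<open>iter\<close>.\<close>

lemma iter_recursion:
  assumes "is_set E T" and "is_set E ((\<lambda>x. opair E x (f x)) ` T)"
    and "a \<in> T" and "\<And>x. x \<in> T \<Longrightarrow> f x \<in> T"
  shows "is_set E ((\<lambda>n. opair E n (iter E f a n)) ` nats E)"
    and "iter E f a (emp E) = a"
    and "n \<in> nats E \<Longrightarrow> iter E f a (succ E n) = f (iter E f a n)"
    and "n \<in> nats E \<Longrightarrow> iter E f a n \<in> T"
proof -
  obtain h where h: "is_set E ((\<lambda>n. opair E n (h n)) ` nats E)" "h (emp E) = a"
    "\<And>n. n \<in> nats E \<Longrightarrow> h n \<in> T \<and> h (succ E n) = f (h n)"
    using recursion[of T f a, OF assms] by blast
  have iter: "iter E f a n = h n" if "n \<in> nats E" for n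
    using h that by (intro iter_eqI) auto
  have "(\<lambda>n. opair E n (iter E f a n)) ` nats E = (\<lambda>n. opair E n (h n)) ` nats E"
    by (intro image_cong) (simp_all add: iter)
  then show "is_set E ((\<lambda>n. opair E n (iter E f a n)) ` nats E)" using h by simp
  show "iter E f a (emp E) = a" by (simp add: iter h)
  show "n \<in> nats E \<Longrightarrow> iter E f a (succ E n) = f (iter E f a n)" by (simp add: iter h)
  show "n \<in> nats E \<Longrightarrow> iter E f a n \<in> T" by (simp add: iter h)
qed

end

section \<open>Abstraction and head reduction\<close>

text \<open>
  The process of \<open>t\<close> with the applications along its spine already pushed: the pole is closed
  under expansion only, so this is what an induction over bracket abstraction can carry.
\<close>

primrec head_in_pole :: "'m ralg \<Rightarrow> (nat \<Rightarrow> 'm) \<Rightarrow> cterm \<Rightarrow> 'm \<Rightarrow> bool" where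
  "head_in_pole A e (Var x) s \<longleftrightarrow> proc A (e x) s \<in> pole A"
| "head_in_pole A e (Comb c) s \<longleftrightarrow> proc A (comb A c) s \<in> pole A"
| "head_in_pole A e (t \<bullet> u) s \<longleftrightarrow> head_in_pole A e t (push A (val A e u) s)"

lemma val_cong: "(\<And>x. occurs x t \<Longrightarrow> e x = e' x) \<Longrightarrow> val A e t = val A e' t"
  by (induction t) auto

lemma head_in_pole_cong:
  "(\<And>x. occurs x t \<Longrightarrow> e x = e' x) \<Longrightarrow> head_in_pole A e t s = head_in_pole A e' t s"
proof (induction t arbitrary: s)
  case (App t u)
  then have "val A e u = val A e' u" by (auto intro: val_cong)
  with App show ?case by simp
qed auto

lemma occurs_lam: "occurs y (lam x t) \<longleftrightarrow> occurs y t \<and> y \<noteq> x"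
  by (induction x t rule: lam.induct) (auto split: cterm.splits)

lemma closed_starred: "(\<And>x. \<not> occurs x t) \<Longrightarrow> \<not> occurs y (starred t)"
proof (induction t)
  case (Comb c)
  show ?case by (cases c) (auto simp: Let_def occurs_lam)
qed auto

section \<open>Execution of compiled terms in the algebra\<close>

locale realizability_model = zf_model E for E :: "'m \<Rightarrow> 'm \<Rightarrow> bool" +
  fixes A :: "'m ralg"
  assumes algebra: "realizability_algebra E A"
begin

lemma algebra_axioms: "ralg_axioms A"
  and is_set_algebra: "is_set E (Terms A)" "is_set E (Stacks A)" "is_set E (pole A)"
  and is_set_graphs:
    "is_set E {opair E (opair E x y) (app A x y) | x y. x \<in> Terms A \<and> y \<in> Terms A}"
    "is_set E {opair E (opair E x s) (push A x s) | x s. x \<in> Terms A \<and> s \<in> Stacks A}"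
    "is_set E {opair E (opair E x s) (proc A x s) | x s. x \<in> Terms A \<and> s \<in> Stacks A}"
  using algebra unfolding realizability_algebra_def by blast+

lemma algebra_closed [simp]:
  "x \<in> Terms A \<Longrightarrow> y \<in> Terms A \<Longrightarrow> app A x y \<in> Terms A"
  "x \<in> Terms A \<Longrightarrow> s \<in> Stacks A \<Longrightarrow> push A x s \<in> Stacks A"
  "s \<in> Stacks A \<Longrightarrow> kont A s \<in> Terms A"
  "comb A c \<in> Terms A"
  using algebra_axioms unfolding ralg_axioms_def by blast+

lemma expand: "step A p q \<Longrightarrow> q \<in> pole A \<Longrightarrow> p \<in> pole A"
  using algebra_axioms unfolding ralg_axioms_def by blast

lemmas expand_app = expand[OF step.intros(1)]
  and expand_I = expand[OF step.intros(2)]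
  and expand_K = expand[OF step.intros(3)]
  and expand_W = expand[OF step.intros(4)]
  and expand_C = expand[OF step.intros(5)]
  and expand_B = expand[OF step.intros(6)]

lemma val_closed [simp]: "(\<And>x. e x \<in> Terms A) \<Longrightarrow> val A e t \<in> Terms A"
  by (induction t) auto

lemma cval_closed [simp]: "cval A t \<in> Terms A"
  unfolding cval_def by simp

lemma starred_kont_closed [simp]: "s \<in> Stacks A \<Longrightarrow> starred_kont A s \<in> Terms A"
  unfolding starred_kont_def Let_def by (intro val_closed) auto

text \<open>The two processes differ only by expansions along the spine.\<close>

lemma proc_val_in_pole:
  assumes "\<And>x. e x \<in> Terms A" and "s \<in> Stacks A" and "head_in_pole A e t s"
  shows "proc A (val A e t) s \<in> pole A"
  using assms(2,3)
proof (induction t arbitrary: s)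
  case (App t u)
  have "proc A (val A e t) (push A (val A e u) s) \<in> pole A"
    using App.prems assms(1) by (intro App.IH) auto
  then show ?case using App.prems assms(1) by (auto intro: expand_app)
qed (auto simp: assms)

text \<open>Correctness of bracket abstraction: a compiled abstraction facing \<open>a\<close> runs
  its body with \<open>a\<close> for \<open>x\<close>. The induction follows the clauses of
  \<open>lam\<close>, each combinator introduced being undone by its expansion rule.\<close>

lemma head_in_pole_lam:
  assumes e: "\<And>x. e x \<in> Terms A" and a: "a \<in> Terms A" and s: "s \<in> Stacks A"
    and "head_in_pole A (e(x := a)) t s"
  shows "head_in_pole A e (lam x t) (push A a s)"
  using s assms(4)
proof (induction x t arbitrary: s rule: lam.induct)
  case (1 x y)
  then show ?case using e a by (auto intro: expand_I expand_K)
next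
  case (2 x c)
  then show ?case using e a by (auto intro: expand_K)
next
  case (3 x t u)
  have e': "(e(x := a)) y \<in> Terms A" for y using e a by simp
  have val_u: "val A (e(x := a)) u = val A e u" if "\<not> occurs x u"
    by (rule val_cong) (use that in auto)
  consider "\<not> occurs x (t \<bullet> u)" | "occurs x (t \<bullet> u)" "\<not> occurs x u"
    | "occurs x t" "u = Var x" | "\<not> occurs x t" "u = Var x"
    | u1 u2 where "occurs x (u1 \<bullet> u2)" "u = u1 \<bullet> u2"
    by (cases u) auto
  then show ?case
  proof cases
    case 1
    \<comment> \<open>\<open>K\<close> brings the body to the head as a single value, so its spine
      must first be folded back.\<close>
    have "proc A (val A (e(x := a)) (t \<bullet> u)) s \<in> pole A"
      by (rule proc_val_in_pole[OF e']) (use "3.prems" in auto)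
    moreover have "val A (e(x := a)) (t \<bullet> u) = val A e (t \<bullet> u)"
      by (rule val_cong) (use 1 in auto)
    ultimately show ?thesis using 1 e a "3.prems"(1) by (auto intro: expand_K)
  next
    case 2
    have "head_in_pole A e (lam x t) (push A a (push A (val A e u) s))"
      using 2 "3.prems" e by (intro "3.IH"(1)) (auto simp: val_u simp del: fun_upd_apply)
    then have "proc A (val A e (lam x t)) (push A a (push A (val A e u) s)) \<in> pole A"
      using e a "3.prems"(1) by (intro proc_val_in_pole) auto
    then show ?thesis using 2 e a "3.prems"(1) by (auto intro: expand_C)
  next
    case 3
    have "head_in_pole A e (lam x t) (push A a (push A a s))"
      using 3 "3.prems" a by (intro "3.IH"(2)) auto
    then have "proc A (val A e (lam x t)) (push A a (push A a s)) \<in> pole A"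
      using e a "3.prems"(1) by (intro proc_val_in_pole) auto
    then show ?thesis using 3 e a "3.prems"(1) by (auto intro: expand_W)
  next
    case 4
    \<comment> \<open>In the eta clause the abstraction is \<open>t\<close> itself, and facing
      \<open>a\<close> it already is the body.\<close>
    have "head_in_pole A e t (push A a s) = head_in_pole A (e(x := a)) t (push A a s)"
      by (rule head_in_pole_cong) (use 4 in auto)
    then show ?thesis using 4 "3.prems" by (simp add: fun_upd_def)
  next
    case 5
    let ?v = "val A (e(x := a))"
    \<comment> \<open>A compound argument is split off by \<open>B\<close>: executing
      \<open>B \<bullet> t \<bullet> u1 \<bullet> u2\<close> regroups it, and the abstraction of
      that term is the recursive call.\<close>
    have "proc A (?v t) (push A (?v u) s) \<in> pole A"
      by (rule proc_val_in_pole[OF e']) (use "3.prems" e' in \<open>simp_all del: fun_upd_apply\<close>)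
    then have "head_in_pole A (e(x := a)) (Defs.B \<bullet> t \<bullet> u1 \<bullet> u2) s"
      using 5 e' "3.prems"(1) by (auto intro!: expand_B)
    then have "head_in_pole A e (lam x (Defs.B \<bullet> t \<bullet> u1 \<bullet> u2)) (push A a s)"
      using 5 "3.prems"(1) by (intro "3.IH"(3)) (auto simp del: fun_upd_apply)
    then show ?thesis using 5 by simp
  qed
qed

lemma cval_in_pole:
  assumes "s \<in> Stacks A" and "head_in_pole A (\<lambda>_. comb A CI) t s"
  shows "proc A (cval A t) s \<in> pole A"
  unfolding cval_def using assms by (intro proc_val_in_pole) auto

lemma val_closed_term: "(\<And>x. \<not> occurs x t) \<Longrightarrow> val A e t = cval A t"
  unfolding cval_def by (rule val_cong) simp

section \<open>The realizers and the starred numerals\<close>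

lemma theta0_in_pole:
  assumes "n \<in> Terms A" "k \<in> Terms A" "x \<in> Terms A" "s \<in> Stacks A"
    and "proc A x (push A n s) \<in> pole A"
  shows "proc A (cval A theta0) (push A n (push A k (push A x s))) \<in> pole A"
  unfolding theta0_def Let_def
  by (intro cval_in_pole head_in_pole_lam) (auto simp: assms)

text \<open>Application in the collapsing algebra inserts \<open>C\<close>, so its successor acts on
  first components as application of this term.\<close>

definition starred_sigma :: 'm where
  "starred_sigma = app A (comb A CC) (cval A (starred sigma))"

lemma starred_sigma_closed [simp]: "starred_sigma \<in> Terms A"
  unfolding starred_sigma_def by simp

text \<open>This is \<open>C B g\<close> with \<open>g\<close> for \<open>starred_sigma\<close>; it
  sends \<open>f\<close> to \<open>B f g\<close>, which is \<open>f\<close> after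
  \<open>g\<close>.\<close>

definition starred_step :: 'm where
  "starred_step = app A (app A (comb A CC) (comb A CB)) starred_sigma"

lemma starred_step_closed [simp]: "starred_step \<in> Terms A"
  unfolding starred_step_def by simp

definition starred_numeral :: "'m \<Rightarrow> 'm" where
  "starred_numeral = iter E (app A starred_sigma) (cval A (starred zero_term))"

lemma theta1_in_pole:
  assumes "n \<in> Terms A" "x \<in> Terms A" "s \<in> Stacks A"
    and "proc A n (push A starred_step (push A (app A (comb A CC) x)
           (push A (cval A (starred zero_term)) (push A (app A (cval A sigma) n) s)))) \<in> pole A"
  shows "proc A (cval A theta1) (push A n (push A x s)) \<in> pole A"
proof -
  \<comment> \<open>Closed subterms keep their value in the environment that binds \<open>n\<close>
    and \<open>x\<close>.\<close>
  have "\<not> occurs x (starred sigma)" "\<not> occurs x (starred zero_term)" "\<not> occurs x sigma" for x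
    by (intro closed_starred; simp add: sigma_def zero_term_def)
       (intro closed_starred, simp add: zero_term_def, simp add: sigma_def)
  note closed = this[THEN val_closed_term]
  show ?thesis
    unfolding theta1_def Let_def
    by (intro cval_in_pole head_in_pole_lam)
      (use assms in \<open>auto simp: closed starred_step_def starred_sigma_def\<close>)
qed

text \<open>Fixing the first argument in the internal graph of \<open>app\<close> gives the internal
  unary graph required by \<open>iter_recursion\<close>.\<close>

lemma iter_app:
  assumes "g \<in> Terms A" and "a \<in> Terms A"
  shows "is_set E ((\<lambda>n. opair E n (iter E (app A g) a n)) ` nats E)"
    and "iter E (app A g) a (emp E) = a"
    and "n \<in> nats E \<Longrightarrow> iter E (app A g) a (succ E n) = app A g (iter E (app A g) a n)"
    and "n \<in> nats E \<Longrightarrow> iter E (app A g) a n \<in> Terms A"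
proof -
  have "is_set E ((\<lambda>x. opair E x (restr2 (Terms A) (Terms A) (app A) g x)) ` Terms A)"
    by (intro is_set_image definable_set_intros is_set_algebra is_set_graphs)
  also have "(\<lambda>x. opair E x (restr2 (Terms A) (Terms A) (app A) g x)) ` Terms A =
      (\<lambda>x. opair E x (app A g x)) ` Terms A"
    using assms by (intro image_cong) auto
  finally have graph: "is_set E ((\<lambda>x. opair E x (app A g x)) ` Terms A)" .
  note * = iter_recursion[OF is_set_algebra(1) this assms(2)]
  show "is_set E ((\<lambda>n. opair E n (iter E (app A g) a n)) ` nats E)"
    and "iter E (app A g) a (emp E) = a"
    and "n \<in> nats E \<Longrightarrow> iter E (app A g) a (succ E n) = app A g (iter E (app A g) a n)"
    and "n \<in> nats E \<Longrightarrow> iter E (app A g) a n \<in> Terms A"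
    using * assms(1) by auto
qed

lemmas numeral_term_iter =
  iter_app[OF cval_closed[of sigma] cval_closed[of zero_term], folded numeral_term_def]

lemmas starred_numeral_iter =
  iter_app[OF starred_sigma_closed cval_closed[of "starred zero_term"],
    folded starred_numeral_def]

text \<open>
  Induction on \<open>n\<close>, for all \<open>x\<close> at once: \<open>n + 1\<close> applied to \<open>f\<close> and \<open>x\<close> reduces to \<open>n\<close> applied
  to \<open>f\<close> and \<open>f x\<close>, and \<open>f x\<close> applied to the \<open>n\<close>-th starred numeral to \<open>x\<close> applied to the next one.
\<close>

lemma numeral_term_iterates:
  assumes n: "n \<in> nats E" and s: "s \<in> Stacks A" and x: "x \<in> Terms A"
    and pole: "proc A x (push A (starred_numeral n) s) \<in> pole A"
  shows "proc A (numeral_term E A n)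
    (push A starred_step (push A x (push A (cval A (starred zero_term)) s))) \<in> pole A"
proof -
  let ?z = "cval A (starred zero_term)"
  let ?proc = "restr2 (Terms A) (Stacks A) (proc A)"
  let ?push = "restr2 (Terms A) (Stacks A) (push A)"
  let ?num = "restr (nats E) (numeral_term E A)"
  let ?star = "restr (nats E) starred_numeral"
  note [simp] = numeral_term_iter(2-4) starred_numeral_iter(2-4)
  \<comment> \<open>Definable total extensions replace the operations so that internal induction
    applies; on their domains nothing changes.\<close>
  have "\<forall>x\<in>Terms A. ?proc x (?push (?star n) s) \<in> pole A \<longrightarrow>
    ?proc (?num n) (?push starred_step (?push x (?push ?z s))) \<in> pole A"
  proof (rule internal_induct[OF n])
    show "definable E (\<lambda>e. \<forall>x\<in>Terms A. ?proc x (?push (?star (e 0)) s) \<in> pole A \<longrightarrow>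
      ?proc (?num (e 0)) (?push starred_step (?push x (?push ?z s))) \<in> pole A)"
      by (intro definable_set_intros is_set_algebra is_set_graphs is_set_nats
          numeral_term_iter(1) starred_numeral_iter(1))
  next
    show "\<forall>x\<in>Terms A. ?proc x (?push (?star (emp E)) s) \<in> pole A \<longrightarrow>
      ?proc (?num (emp E)) (?push starred_step (?push x (?push ?z s))) \<in> pole A"
    proof (intro ballI impI)
      fix x assume x: "x \<in> Terms A" and "?proc x (?push (?star (emp E)) s) \<in> pole A"
      then have "proc A x (push A ?z s) \<in> pole A" using s by simp
      \<comment> \<open>The numeral \<open>K I\<close> discards the step, and \<open>I\<close> then
        runs \<open>x\<close>.\<close>
      then have "proc A (cval A zero_term) (push A starred_step (push A x (push A ?z s))) \<in> pole A"
        using s x unfolding zero_term_def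
        by (intro cval_in_pole) (auto intro!: expand_K expand_I)
      then show "?proc (?num (emp E)) (?push starred_step (?push x (?push ?z s))) \<in> pole A"
        using s x by simp
    qed
  next
    fix k assume k: "k \<in> nats E" and IH: "\<forall>x\<in>Terms A. ?proc x (?push (?star k) s) \<in> pole A \<longrightarrow>
      ?proc (?num k) (?push starred_step (?push x (?push ?z s))) \<in> pole A"
    show "\<forall>x\<in>Terms A. ?proc x (?push (?star (succ E k)) s) \<in> pole A \<longrightarrow>
      ?proc (?num (succ E k)) (?push starred_step (?push x (?push ?z s))) \<in> pole A"
    proof (intro ballI impI)
      fix x assume x: "x \<in> Terms A" and "?proc x (?push (?star (succ E k)) s) \<in> pole A"
      then have *: "proc A x (push A (app A starred_sigma (starred_numeral k)) s) \<in> pole A"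
        using s k by simp
      have "proc A (app A starred_step x) (push A (starred_numeral k) s) \<in> pole A"
        unfolding starred_step_def
        by (intro expand_app expand_C expand_B *) (use s x k in auto)
      then have **: "proc A (numeral_term E A k)
          (push A starred_step (push A (app A starred_step x) (push A ?z s))) \<in> pole A"
        using IH[rule_format, of "app A starred_step x"] s x k by simp
      have sigma: "cval A sigma =
          app A (app A (comb A CB) (comb A CW)) (app A (comb A CB) (comb A CB))"
        by (simp add: sigma_def cval_def)
      \<comment> \<open>In \<open>sigma\<close>, \<open>W\<close> duplicates the step; one copy goes
        to the numeral \<open>k\<close>, and \<open>B\<close> applies the other to
        \<open>x\<close>.\<close>
      have "proc A (app A (cval A sigma) (numeral_term E A k))
          (push A starred_step (push A x (push A ?z s))) \<in> pole A"
        unfolding sigma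
        by (intro expand_app expand_B expand_W **) (use s x k in auto)
      then show "?proc (?num (succ E k)) (?push starred_step (?push x (?push ?z s))) \<in> pole A"
        using s x k by simp
    qed
  qed
  then show ?thesis using assms by simp
qed

end

section \<open>The generic surjection\<close>

locale collapse = realizability_model E A for E :: "'m \<Rightarrow> 'm \<Rightarrow> bool" and A :: "'m ralg" +
  fixes \<kappa> zero :: 'm
  assumes zero: "zero \<notin> tree E \<kappa>" and well_defined: "pole_B_well_defined E A zero \<kappa>"
begin

section \<open>Computation in the collapsing algebra\<close>

abbreviation "alg \<equiv> alg_B E A zero \<kappa>"
abbreviation "cond \<equiv> conditions E zero \<kappa>"

lemma alg_simps [simp]:
  "Terms alg = mprod E (Terms A) cond"
  "Stacks alg = mprod E (Stacks A) cond"
  "app alg (opair E x p) (opair E y q) =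
    opair E (app A (app A (comb A CC) x) y) (pmult E zero p q)"
  "push alg (opair E x p) (opair E s q) = opair E (push A x s) (pmult E zero p q)"
  "proc alg (opair E x p) (opair E s q) = opair E (proc A x s) (pmult E zero p q)"
  "kont alg (opair E s p) = opair E (starred_kont A s) p"
  "comb alg c = opair E (cval A (starred_comb c)) (emp E)"
  by (simp_all add: alg_B_def Let_def)

lemma opair_mem_mprod [simp]: "opair E x y \<in> mprod E X Y \<longleftrightarrow> x \<in> X \<and> y \<in> Y"
  unfolding mprod_def by auto

lemma emp_tree [simp]: "emp E \<in> tree E \<kappa>"
  unfolding tree_def by (auto simp: is_fun_def fdom_def fran_def intro: bexI[of _ "emp E"])

lemma emp_cond [simp]: "emp E \<in> cond"
  unfolding conditions_def by simp

lemma pmult_emp [simp]: "pmult E zero (emp E) p = p"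
  using zero emp_tree unfolding pmult_def by auto

lemma pmult_extension:
  "p \<noteq> zero \<Longrightarrow> q \<noteq> zero \<Longrightarrow> ext E p \<subseteq> ext E q \<Longrightarrow> pmult E zero p q = q"
  unfolding pmult_def by simp

lemma pmult_cond [simp]: "p \<in> cond \<Longrightarrow> q \<in> cond \<Longrightarrow> pmult E zero p q \<in> cond"
  unfolding pmult_def conditions_def by auto

lemma pmult_nonzero:
  assumes "pmult E zero p q \<noteq> zero"
  shows "p \<noteq> zero" "q \<noteq> zero"
    "ext E p \<subseteq> ext E (pmult E zero p q)" "ext E q \<subseteq> ext E (pmult E zero p q)"
  using assms unfolding pmult_def by (auto split: if_splits)

text \<open>The pole refers to some representatives of a process; \<open>well_defined\<close> lets
  membership be read off the given \<open>x\<close> and \<open>s\<close>.\<close>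

lemma proc_in_pole_alg:
  assumes "x \<in> Terms A" "s \<in> Stacks A" "p \<in> cond" "q \<in> cond"
  shows "proc alg (opair E x p) (opair E s q) \<in> pole alg \<longleftrightarrow>
    in_pole_B E A zero x s (pmult E zero p q)"
  using assms well_defined unfolding pole_B_well_defined_def by simp

text \<open>The successor of \<open>alg\<close> has condition \<open>emp E\<close>, the unit of the
  product, so iterating it only builds up the first component.\<close>

lemma numeral_term_alg:
  assumes "n \<in> nats E"
  shows "numeral_term E alg n = opair E (starred_numeral n) (emp E)"
  unfolding numeral_term_def
proof (rule iter_eqI[OF _ _ _ assms])
  have "is_set E ((\<lambda>n. opair E n (opair E (restr (nats E) starred_numeral n) (emp E))) ` nats E)"
    by (intro is_set_image definable_set_intros is_set_nats starred_numeral_iter(1))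
  also have "(\<lambda>n. opair E n (opair E (restr (nats E) starred_numeral n) (emp E))) ` nats E =
      (\<lambda>n. opair E n (opair E (starred_numeral n) (emp E))) ` nats E"
    by (intro image_cong) auto
  finally show "is_set E ((\<lambda>n. opair E n (opair E (starred_numeral n) (emp E))) ` nats E)" .
  \<comment> \<open>\<open>app alg\<close> inserts the same \<open>C\<close> as
    \<open>starred\<close> does.\<close>
  show "opair E (starred_numeral (emp E)) (emp E) = cval alg zero_term"
    unfolding starred_numeral_iter(2) zero_term_def by (simp add: cval_def)
  have "cval alg sigma = opair E (cval A (starred sigma)) (emp E)"
    unfolding sigma_def by (simp add: cval_def)
  then show "opair E (starred_numeral (succ E k)) (emp E) =
      app alg (cval alg sigma) (opair E (starred_numeral k) (emp E))" if "k \<in> nats E" for k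
    using that by (simp add: starred_numeral_iter(3) starred_sigma_def)
qed

text \<open>All positions from the length \<open>m\<close> of \<open>p\<close> up to
  \<open>n\<close> receive the value \<open>y\<close>, not only \<open>n\<close>, so that the new
  domain is again an integer.\<close>

lemma tree_extension:
  assumes p: "p \<in> tree E \<kappa>" and n: "n \<in> nats E" and dom: "fdom E p \<subseteq> ext E n" and y: "E y \<kappa>"
  shows "\<exists>q\<in>tree E \<kappa>. ext E p \<subseteq> ext E q \<and> fdom E q = ext E (succ E n) \<and> E (opair E n y) q"
proof -
  obtain m where m: "m \<in> nats E" "fdom E p = ext E m" and p_fun: "is_fun E p"
    and p_ran: "fran E p \<subseteq> ext E \<kappa>"
    using p unfolding tree_def by blast
  have "is_set E {i \<in> ext E (succ E n). \<not> E i m}"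
    by (intro separation definable_set_intros is_set_ext)
  then have "is_set E (ext E p \<union> (\<lambda>i. opair E i y) ` {i \<in> ext E (succ E n). \<not> E i m})"
    by (intro is_set_Un is_set_ext is_set_image definable_set_intros)
  then obtain q where q_def:
    "ext E q = ext E p \<union> (\<lambda>i. opair E i y) ` {i \<in> ext E (succ E n). \<not> E i m}"
    by (rule is_setE)
  have q: "E z q \<longleftrightarrow> E z p \<or> (\<exists>i. (i = n \<or> E i n) \<and> \<not> E i m \<and> z = opair E i y)" for z
    using q_def unfolding set_eq_iff image_iff Un_iff Bex_def mem_Collect_eq mem_ext mem_simps
    by blast
  have dom_p: "E i m \<longleftrightarrow> (\<exists>x. E (opair E i x) p)" for i
    using m(2) unfolding fdom_def set_eq_iff by auto
  have m_n: "E i n" if "E i m" for i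
    using that dom m(2) by auto
  have "is_fun E q"
    using p_fun dom_p unfolding is_fun_def q by auto
  moreover have "fdom E q = ext E (succ E n)"
    using dom_p m_n unfolding fdom_def q set_eq_iff by auto
  moreover have "fran E q \<subseteq> ext E \<kappa>"
    using p_ran y unfolding fran_def q by auto
  moreover have "E (opair E n y) q"
    using m_n mem_irrefl unfolding q by blast
  moreover have "ext E p \<subseteq> ext E q"
    using q_def by blast
  ultimately show ?thesis
    using succ_nats[OF n] by (intro bexI[of _ q]) (auto simp: tree_def simp del: ext_succ)
qed

section \<open>The two realizability statements\<close>

context
  fixes \<G> :: 'm
  assumes generic: "ext E \<G> = generic_ext E A zero \<kappa>"
begin

lemma mem_generic:
  "E (opair E (opair E m a) (opair E s p)) \<G> \<longleftrightarrow>
    m \<in> nats E \<and> E a \<kappa> \<and> s \<in> Stacks A \<and> p \<in> tree E \<kappa> \<and> E (opair E m a) p" (is "?l = ?r")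
proof -
  have "?l \<longleftrightarrow> opair E (opair E m a) (opair E s p) \<in> generic_ext E A zero \<kappa>"
    using generic mem_ext by blast
  also have "\<dots> \<longleftrightarrow> m \<in> nats E \<and> E a \<kappa> \<and> s \<in> Stacks A \<and> p \<in> tree E \<kappa> \<and>
      m \<in> fdom E p \<and> fapp E p m = a"
    unfolding generic_ext_def conditions_def using zero by auto
  also have "\<dots> \<longleftrightarrow> ?r"
  proof -
    have "m \<in> fdom E p \<and> fapp E p m = a \<longleftrightarrow> E (opair E m a) p" if "p \<in> tree E \<kappa>"
    proof -
      have "is_fun E p" using that unfolding tree_def by blast
      then show ?thesis using mem_fapp fapp_eqI unfolding fdom_def by blast
    qed
    then show ?thesis by blast
  qed
  finally show ?thesis .
qed

lemma generic_functional:
  "realizes E alg (opair E (cval A theta0) (emp E))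
     (All (\<lambda>x. All (\<lambda>y. All (\<lambda>y'.
        Eps (opair E x y) \<G> (NotEq y y' \<^bold>\<rightarrow> NotEps (opair E x y') \<G>)))))"
  unfolding realizes_def realizer_def
proof (intro conjI ballI)
  show "opair E (cval A theta0) (emp E) \<in> Terms alg" by simp
  fix t assume "t \<in> truth_value E alg (All (\<lambda>x. All (\<lambda>y. All (\<lambda>y'.
    Eps (opair E x y) \<G> (NotEq y y' \<^bold>\<rightarrow> NotEps (opair E x y') \<G>)))))"
  then obtain x y y' r z s where t: "t = push alg (kont alg r) (push alg z s)"
    and r: "r \<in> Stacks alg" "E (opair E (opair E x y) r) \<G>"
    and z: "realizer alg z (truth_value E alg (NotEq y y'))"
    and s: "s \<in> Stacks alg" "E (opair E (opair E x y') s) \<G>"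
    by (auto simp del: alg_simps)
  obtain \<rho> p where rp: "r = opair E \<rho> p" "\<rho> \<in> Stacks A" "p \<in> cond"
    using r(1) by (auto simp: mprod_def)
  obtain \<pi> p' where sp: "s = opair E \<pi> p'" "\<pi> \<in> Stacks A" "p' \<in> cond"
    using s(1) by (auto simp: mprod_def)
  obtain \<xi> q where zq: "z = opair E \<xi> q" "\<xi> \<in> Terms A" "q \<in> cond"
    using z unfolding realizer_def by (auto simp: mprod_def)
  have "in_pole_B E A zero (cval A theta0)
      (push A (starred_kont A \<rho>) (push A \<xi> \<pi>)) (pmult E zero p (pmult E zero q p'))"
    (is "in_pole_B E A zero _ _ ?P")
    unfolding in_pole_B_def
  proof (intro ballI impI, elim conjE)
    fix n assume n: "n \<in> nats E" and P: "?P \<noteq> zero" and dom: "fdom E ?P \<subseteq> ext E n"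
    note nonzero = pmult_nonzero[OF P] pmult_nonzero[OF pmult_nonzero(2)[OF P]]
    have "?P \<in> tree E \<kappa>"
      using P rp sp zq pmult_cond unfolding conditions_def by blast
    then have "is_fun E ?P" unfolding tree_def by blast
    moreover have "ext E p \<subseteq> ext E ?P" "ext E p' \<subseteq> ext E ?P"
      using nonzero by blast+
    \<comment> \<open>A nonzero product extends each factor, so both values at \<open>x\<close> are
      values of the one function \<open>?P\<close>.\<close>
    then have "E (opair E x y) ?P" "E (opair E x y') ?P"
      using r(2) s(2) unfolding rp sp mem_generic by (auto simp: subset_iff)
    ultimately have "y = y'" unfolding is_fun_def by blast
    \<comment> \<open>For equal \<open>y\<close> and \<open>y'\<close> the truth value of
      \<open>NotEq\<close> consists of all stacks, so \<open>z\<close> may be run against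
      \<open>s\<close>.\<close>
    then have "proc alg z s \<in> pole alg"
      using z s(1) unfolding realizer_def by simp
    then have "in_pole_B E A zero \<xi> \<pi> (pmult E zero q p')"
      using proc_in_pole_alg[OF zq(2) sp(2) zq(3) sp(3)] unfolding zq(1) sp(1) by blast
    \<comment> \<open>The bound \<open>n\<close> serves for the smaller product as well, so
      \<open>theta0\<close> can hand it on unchanged.\<close>
    moreover have "fdom E (pmult E zero q p') \<subseteq> ext E n"
      using dom nonzero(4) unfolding fdom_def by (auto simp: subset_iff)
    ultimately have "proc A \<xi> (push A (numeral_term E A n) \<pi>) \<in> pole A"
      using n nonzero(2) unfolding in_pole_B_def by blast
    then show "proc A (cval A theta0) (push A (numeral_term E A n)
        (push A (starred_kont A \<rho>) (push A \<xi> \<pi>))) \<in> pole A"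
      using n rp sp zq by (intro theta0_in_pole) (simp_all add: numeral_term_iter(4))
  qed
  then show "proc alg (opair E (cval A theta0) (emp E)) t \<in> pole alg"
    using proc_in_pole_alg[of "cval A theta0" "push A (starred_kont A \<rho>) (push A \<xi> \<pi>)" "emp E" ?P]
      rp sp zq unfolding t by simp
qed

lemma generic_surjective:
  "realizes E alg (opair E (cval A theta1) (emp E))
     (AllGimel \<kappa> (\<lambda>y. AllInt (\<lambda>x. NotEps (opair E x y) \<G>) \<^bold>\<rightarrow> Falsum))"
  unfolding realizes_def realizer_def
proof (intro conjI ballI)
  show "opair E (cval A theta1) (emp E) \<in> Terms alg" by simp
  fix t assume "t \<in> truth_value E alg
    (AllGimel \<kappa> (\<lambda>y. AllInt (\<lambda>x. NotEps (opair E x y) \<G>) \<^bold>\<rightarrow> Falsum))"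
  then obtain y z s where t: "t = push alg z s" and y: "E y \<kappa>"
    and z: "realizer alg z (truth_value E alg (AllInt (\<lambda>x. NotEps (opair E x y) \<G>)))"
    and s: "s \<in> Stacks alg"
    by (auto simp del: alg_simps)
  obtain \<pi> p where sp: "s = opair E \<pi> p" "\<pi> \<in> Stacks A" "p \<in> cond"
    using s by (auto simp: mprod_def)
  obtain \<xi> q where zq: "z = opair E \<xi> q" "\<xi> \<in> Terms A" "q \<in> cond"
    using z unfolding realizer_def by (auto simp: mprod_def)
  have "in_pole_B E A zero (cval A theta1) (push A \<xi> \<pi>) (pmult E zero q p)"
    (is "in_pole_B E A zero _ _ ?P")
    unfolding in_pole_B_def
  proof (intro ballI impI, elim conjE)
    fix n assume n: "n \<in> nats E" and P: "?P \<noteq> zero" and dom: "fdom E ?P \<subseteq> ext E n"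
    have "?P \<in> tree E \<kappa>"
      using P sp zq pmult_cond unfolding conditions_def by blast
    from tree_extension[OF this n dom y] obtain r where r: "r \<in> tree E \<kappa>"
      "ext E ?P \<subseteq> ext E r" "fdom E r = ext E (succ E n)" "E (opair E n y) r"
      by blast
    have r_cond: "r \<in> cond" "r \<noteq> zero" using r zero unfolding conditions_def by auto
    \<comment> \<open>\<open>q\<close> is contained in \<open>?P\<close> and hence in
      \<open>r\<close>, so multiplying by \<open>q\<close> leaves \<open>r\<close>
      unchanged.\<close>
    have qr: "pmult E zero q r = r"
      using pmult_nonzero[OF P] r r_cond by (intro pmult_extension) auto
    have star: "starred_numeral n \<in> Terms A" and num: "numeral_term E A n \<in> Terms A"
      using n starred_numeral_iter(4) numeral_term_iter(4) by auto
    \<comment> \<open>The value of \<open>r\<close> at \<open>n\<close> is \<open>y\<close>, so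
      \<open>\<pi>\<close> with condition \<open>r\<close> refutes non-membership at the integer
      \<open>n\<close>.\<close>
    have "opair E \<pi> r \<in> truth_value E alg (NotEps (opair E n y) \<G>)"
      using n y sp r r_cond mem_generic by simp
    then have "push alg (numeral_term E alg n) (opair E \<pi> r) \<in>
        truth_value E alg (AllInt (\<lambda>x. NotEps (opair E x y) \<G>))"
      using n unfolding truth_value.simps by blast
    then have "proc alg z (push alg (numeral_term E alg n) (opair E \<pi> r)) \<in> pole alg"
      using z unfolding realizer_def by blast
    then have "in_pole_B E A zero \<xi> (push A (starred_numeral n) \<pi>) r"
      using proc_in_pole_alg[of \<xi> "push A (starred_numeral n) \<pi>" q r] zq sp r_cond star qr
      by (simp add: numeral_term_alg n)
    \<comment> \<open>The domain of \<open>r\<close> is one longer than the bound \<open>n\<close>;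
      this is why \<open>theta1\<close> passes \<open>sigma\<close> applied to
      \<open>n\<close>.\<close>
    then have "proc A \<xi> (push A (numeral_term E A (succ E n)) (push A (starred_numeral n) \<pi>)) \<in> pole A"
      using r(3) r_cond(2) succ_nats[OF n] unfolding in_pole_B_def by blast
    then have *: "proc A \<xi> (push A (app A (cval A sigma) (numeral_term E A n))
        (push A (starred_numeral n) \<pi>)) \<in> pole A"
      using n by (simp add: numeral_term_iter(3))
    \<comment> \<open>The iteration delivers the starred numeral ahead of the length bound, while
      \<open>\<xi>\<close> expects the bound first; \<open>C\<close> exchanges them.\<close>
    have "proc A (app A (comb A CC) \<xi>) (push A (starred_numeral n)
        (push A (app A (cval A sigma) (numeral_term E A n)) \<pi>)) \<in> pole A"
      by (intro expand_app expand_C *) (use zq sp star num in auto)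
    then show "proc A (cval A theta1) (push A (numeral_term E A n) (push A \<xi> \<pi>)) \<in> pole A"
      using zq sp n num by (intro theta1_in_pole numeral_term_iterates) auto
  qed
  then show "proc alg (opair E (cval A theta1) (emp E)) t \<in> pole alg"
    using proc_in_pole_alg[of "cval A theta1" "push A \<xi> \<pi>" "emp E" ?P] sp zq
    unfolding t by simp
qed

end

end

theorem theorem34:
  fixes E :: "'m \<Rightarrow> 'm \<Rightarrow> bool"
    and A :: "'m ralg"
    and \<kappa> zero \<G> :: 'm
  assumes "ZF_model E" and "V_eq_L E"
    and "realizability_algebra E A"
    and "infinite_cardinal E \<kappa>" and "injects E (Terms A \<union> Stacks A) (ext E \<kappa>)"
    and "zero \<notin> tree E \<kappa>"
    and "pole_B_well_defined E A zero \<kappa>"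
    and "ext E \<G> = generic_ext E A zero \<kappa>"
  shows "realizes E (alg_B E A zero \<kappa>) (opair E (cval A theta0) (emp E))
           (All (\<lambda>x. All (\<lambda>y. All (\<lambda>y'.
              Eps (opair E x y) \<G> (NotEq y y' \<^bold>\<rightarrow> NotEps (opair E x y') \<G>)))))
       \<and> realizes E (alg_B E A zero \<kappa>) (opair E (cval A theta1) (emp E))
           (AllGimel \<kappa> (\<lambda>y. AllInt (\<lambda>x. NotEps (opair E x y) \<G>) \<^bold>\<rightarrow> Falsum))"
proof -
  interpret collapse E A \<kappa> zero
    using assms by unfold_locales
  show ?thesis
    using generic_functional generic_surjective assms(8) by blast
qed

end
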